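(* Let $n\ge 2$ and $N$ be positive integers. There exists a positive integer $d$, depending only on $N$ and $n$, such that for every $(r_1,\dots,r_n)\in\mathbb{Z}_{>0}^n$ with $\sum_{i=1}^n r_i=N$ and all integers $q\ge 1$, $p_1,\dots,p_{n-1}$ with $\gcd(p_i,q)=1$ for $i=1,\dots,n-1$, the number $$\frac{d\,q^{N-n+1}}{r_1!\cdots r_n!}\,s_{r_1,\dots,r_n}(q;p_1,\dots,p_{n-1})$$ is an integer and $$\frac{d\,q^{N-n+1}}{r_1!\cdots r_n!}\,s_{r_1,\dots,r_n}(q;p_1,\dots,p_{n-1})\;\equiv\;\sum_{(m_1,\dots,m_n)}(-d)\prod_{i=1}^n\frac{B_{m_i}}{m_i!}\binom{m_i-1}{r_i-1}p_i^{m_i-r_i}\pmod q ,$$ where $p_n:=-1$ and the sum is over all $n$-tuples $(m_1,\dots,m_n)$ of non-negative even integers with $\sum_{i=1}^n m_i=N$ such that at least one $m_i$ is zero. (Here the coefficients $d\prod_{i=1}^n B_{m_i}/m_i!$ are integers, so that the right-hand side makes sense modulo $q$.)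
   Context: Bernoulli polynomials $B_k(x)$ are defined by $\frac{ze^{xz}}{e^z-1}=\sum_{k\ge0}\frac{B_k(x)}{k!}z^k$, and $B_k=B_k(0)$. The periodic Bernoulli function $\tilde B_k:\mathbb{R}\to\mathbb{R}$ has period $1$, with $\tilde B_k(t)=B_k(t)$ for $t\in(0,1)$, $\tilde B_k(0)=B_k$ for $k\neq1$, and $\tilde B_1(0)=0$. The generalized Dedekind sum of index $(r_1,\dots,r_n)$ is $$s_{r_1,\dots,r_n}(q;p_1,\dots,p_{n-1})=\sum_{k_1,\dots,k_{n-1}\in\mathbb{Z}/q\mathbb{Z}}\tilde B_{r_1}\!\left(\tfrac{k_1}{q}\right)\cdots\tilde B_{r_{n-1}}\!\left(\tfrac{k_{n-1}}{q}\right)\tilde B_{r_n}\!\left(\tfrac{\sum_{i=1}^{n-1}p_ik_i}{q}\right).$$ Binomial coefficients are $\binom{a}{k}=a(a-1)\cdots(a-k+1)/k!$ for $a\in\mathbb{Z}$, $k\ge0$; in particular $\binom{-1}{k}=(-1)^k$. Negative powers of $p_i$ modulo $q$ are powers of the inverse of $p_i$ modulo $q$. *)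

theory Defs
  imports
    Complex_Main
    "HOL-Library.FuncSet"
    "HOL-Number_Theory.Modular_Inverse"
    "HOL-Computational_Algebra.Formal_Power_Series"
begin

(* z e^(xz) / (e^z - 1) = \<Sum> B_k(x) z^k / k!, as a quotient of formal power series in z. *)
definition bernoulli_gf :: "real \<Rightarrow> real fps" where
  "bernoulli_gf x = fps_X * fps_exp x / (fps_exp 1 - 1)"

definition bernoulli_poly :: "nat \<Rightarrow> real \<Rightarrow> real" where
  "bernoulli_poly k x = fact k * fps_nth (bernoulli_gf x) k"

definition bernoulli_number :: "nat \<Rightarrow> real" where
  "bernoulli_number k = bernoulli_poly k 0"

(* fps division is total, so we record that the quotient is exact. *)
lemma bernoulli_gf_times: "bernoulli_gf x * (fps_exp 1 - 1) = fps_X * fps_exp x"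
proof -
  have "fps_nth (fps_exp (1::real) - 1) 1 \<noteq> 0"
    by simp
  then have nz: "fps_exp (1::real) - 1 \<noteq> 0"
    by fastforce
  have "subdegree (fps_exp (1::real) - 1) = 1"
    by (intro subdegreeI) auto
  moreover have "subdegree (fps_X * fps_exp x) \<ge> 1"
    by (intro subdegree_geI) auto
  ultimately have "(fps_exp 1 - 1) dvd fps_X * fps_exp x"
    using nz by (simp add: fps_dvd_iff)
  then show ?thesis
    by (simp add: bernoulli_gf_def)
qed

definition periodic_bernoulli :: "nat \<Rightarrow> real \<Rightarrow> real" where
  "periodic_bernoulli k t =
     (if t \<in> \<int> then (if k = 1 then 0 else bernoulli_number k) else bernoulli_poly k (frac t))"

(* r is read on {1..n} and p on {1..n-1}; Z/qZ is represented by {0..<q}. *)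
definition dedekind_sum :: "nat \<Rightarrow> (nat \<Rightarrow> nat) \<Rightarrow> int \<Rightarrow> (nat \<Rightarrow> int) \<Rightarrow> real" where
  "dedekind_sum n r q p =
     (\<Sum>k \<in> {1..n-1} \<rightarrow>\<^sub>E {0..<q}.
        (\<Prod>i=1..n-1. periodic_bernoulli (r i) (of_int (k i) / of_int q)) *
        periodic_bernoulli (r n) (of_int (\<Sum>i=1..n-1. p i * k i) / of_int q))"

definition even_tuples :: "nat \<Rightarrow> nat \<Rightarrow> (nat \<Rightarrow> nat) set" where
  "even_tuples n N =
     {m \<in> {1..n} \<rightarrow>\<^sub>E UNIV.
        (\<forall>i\<in>{1..n}. even (m i)) \<and> (\<Sum>i=1..n. m i) = N \<and> (\<exists>i\<in>{1..n}. m i = 0)}"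

(* The parse-time sort constraint on gchoose available here is field_char_0, which excludes int;
   binomial_int is the int instance of gchoose written out.  The division is exact. *)
definition binomial_int :: "int \<Rightarrow> nat \<Rightarrow> int" where
  "binomial_int a k = (\<Prod>i=0..<k. a - int i) div fact k"

lemma of_int_binomial_int: "real_of_int (binomial_int a k) = real_of_int a gchoose k"
  by (simp flip: of_int_gbinomial add: binomial_int_def gbinomial_prod_rev[where 'a = int])

(* A representative of a^e modulo q, meaningful for e < 0 when a is coprime to q. *)
definition mod_power_int :: "int \<Rightarrow> int \<Rightarrow> int \<Rightarrow> int" where
  "mod_power_int q a e =
     (if e \<ge> 0 then a ^ nat e else modular_inverse q a ^ nat (- e))"

end

theory Submission
  imports Defs "HOL-Computational_Algebra.Polynomial"
begin

text \<open>
  Finite Fourier analysis on \<open>\<int>/q\<close> turns \<open>q\<^sup>N\<^sup>-\<^sup>n\<^sup>+\<^sup>1 s / (r\<^sub>1! \<cdots> r\<^sub>n!)\<close> into the sum over all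
  \<open>q\<close>-th roots of unity \<open>\<zeta>\<close> of \<open>\<Prod>i. F\<^sub>i(\<zeta>^p\<^sub>i)\<close>, where for \<open>x \<noteq> 1\<close> the number \<open>F\<^sub>i(x)\<close> is the coefficient of
  \<open>z^r\<^sub>i\<close> in \<open>z / (x e\<^sup>z - 1)\<close>, a polynomial in \<open>1 / (x - 1)\<close> (up to the correction of the first Bernoulli
  function). With \<open>a\<close> a representative of \<open>p\<^sub>i\<close> and \<open>a b \<equiv> 1 (mod q)\<close>, the quotient \<open>1 / (\<zeta>\<^sup>a - 1)\<close> equals
  \<open>(1 + \<zeta>\<^sup>a + \<cdots> + \<zeta>^(a(b-1))) / (\<zeta> - 1)\<close>, so the summand is \<open>H(\<zeta>) / (\<zeta> - 1)\<^sup>N\<close> for a polynomial \<open>H\<close>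
  with only a bounded denominator. For such functions the sum over \<open>\<zeta> \<noteq> 1\<close> is, modulo \<open>q\<close> and up to bounded
  denominators, minus the constant term of \<open>H(e\<^sup>u) / (e\<^sup>u - 1)\<^sup>N\<close>. Modulo \<open>q\<close> the factors of this constant
  term become the series \<open>\<Sum>m. B\<^sub>m / m! (m - 1 choose r\<^sub>i - 1) p\<^sub>i^(m - r\<^sub>i) u^(m - r\<^sub>i)\<close>. Only the tuples with a zero
  entry and the tuple \<open>m = r\<close> contribute, and the latter cancels the term \<open>\<zeta> = 1\<close>.
\<close>

section \<open>The polynomials of the coefficients of 1 / (x exp z - 1)\<close>

text \<open>
  The coefficient of \<open>z\<^sup>s\<close> in \<open>1 / (x e\<^sup>z - 1)\<close> is \<open>hpoly s y 1 / s!\<close> with \<open>y = 1 / (x - 1)\<close>, and \<open>t\<close> makes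
  the polynomial homogeneous of degree \<open>s + 1\<close>. Multiplying by \<open>s!\<close> makes the coefficients integers, so
  that it can be evaluated in any commutative ring.
\<close>

fun hpoly :: "nat \<Rightarrow> 'a::comm_ring_1 \<Rightarrow> 'a \<Rightarrow> 'a" where
  "hpoly 0 z t = z"
| "hpoly (Suc s) z t =
     - (t + z) * (\<Sum>j\<le>s. of_nat (Suc s choose Suc j) * hpoly (s - j) z t * t ^ j)"

text \<open>Every summand of the recursion has total degree \<open>Suc s\<close>, and the factor
  \<open>t + z\<close> adds one. This moves powers of \<open>x - 1\<close> or of \<open>bgf\<close>
  into and out of both arguments.\<close>

lemma hpoly_homogeneous: "hpoly s (c * z) (c * t) = c ^ Suc s * hpoly s z t"
proof (induction s rule: less_induct)
  case (less s)
  show ?case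
  proof (cases s)
    case (Suc r)
    have "(\<Sum>j\<le>r. of_nat (Suc r choose Suc j) * hpoly (r - j) (c * z) (c * t) * (c * t) ^ j)
        = c ^ Suc r * (\<Sum>j\<le>r. of_nat (Suc r choose Suc j) * hpoly (r - j) z t * t ^ j)"
      unfolding sum_distrib_left
    proof (rule sum.cong[OF refl])
      fix j assume j: "j \<in> {..r}"
      have "c ^ Suc (r - j) * c ^ j = c ^ Suc r"
        using j by (simp flip: power_add power_Suc)
      then have e: "c ^ Suc r * x = c ^ Suc (r - j) * c ^ j * x" for x
        by simp
      have "hpoly (r - j) (c * z) (c * t) = c ^ Suc (r - j) * hpoly (r - j) z t"
        using Suc by (intro less) simp
      then show "of_nat (Suc r choose Suc j) * hpoly (r - j) (c * z) (c * t) * (c * t) ^ j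
          = c ^ Suc r * (of_nat (Suc r choose Suc j) * hpoly (r - j) z t * t ^ j)"
        by (simp only: e power_mult_distrib mult_ac)
    qed
    then show ?thesis
      unfolding Suc hpoly.simps by (simp add: algebra_simps)
  qed simp
qed

text \<open>Only ring operations occur in \<open>hpoly\<close>, so it commutes with evaluation of
  polynomials and with substitution into power series.\<close>

lemma hpoly_hom:
  fixes f :: "'a::comm_ring_1 \<Rightarrow> 'b::comm_ring_1"
  assumes add: "\<And>x y. f (x + y) = f x + f y" and mult: "\<And>x y. f (x * y) = f x * f y"
    and one: "f 1 = 1"
  shows "f (hpoly s z t) = hpoly s (f z) (f t)"
proof (induction s rule: less_induct)
  case (less s)
  have zero: "f 0 = 0"
    using add[of 0 0] by simp
  have minus: "f (- x) = - f x" for x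
    using add[of x "- x"] zero by (simp add: eq_neg_iff_add_eq_0 add.commute)
  have nat: "f (of_nat k) = of_nat k" for k
    by (induction k) (simp_all add: zero one add)
  have power: "f (x ^ k) = f x ^ k" for x k
    by (induction k) (simp_all add: one mult)
  have sum: "f (sum g A) = (\<Sum>x\<in>A. f (g x))" for g and A :: "nat set"
    by (induction A rule: infinite_finite_induct) (simp_all add: zero add)
  show ?case
  proof (cases s)
    case (Suc r)
    then have "f (hpoly (r - j) z t) = hpoly (r - j) (f z) (f t)" for j
      by (intro less) simp
    then show ?thesis
      by (simp only: Suc hpoly.simps minus mult sum add power nat)
  qed simp
qed

lemma hpoly_unique:
  assumes "f 0 = z"
    and "\<And>s. f (Suc s) = - (t + z) * (\<Sum>j\<le>s. of_nat (Suc s choose Suc j) * f (s - j) * t ^ j)"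
  shows "hpoly s z t = f s"
proof (induction s rule: less_induct)
  case (less s)
  show ?case
  proof (cases s)
    case (Suc r)
    then have "hpoly (r - j) z t = f (r - j)" for j
      by (intro less) simp
    then show ?thesis
      by (simp only: Suc hpoly.simps assms(2))
  qed (simp add: assms(1))
qed

text \<open>Only the summand \<open>j = 0\<close> survives. This gives the nonzero value of
  \<open>hpoly M 1 (x - 1)\<close> at \<open>x = 1\<close>.\<close>

lemma hpoly_at_0: "hpoly s z 0 = (- 1) ^ s * fact s * z ^ Suc s"
proof (induction s)
  case (Suc s)
  have "(\<Sum>j\<le>s. of_nat (Suc s choose Suc j) * hpoly (s - j) z 0 * 0 ^ j)
      = of_nat (Suc s) * hpoly s z 0"
    by (subst sum.remove[of _ 0]) (auto intro!: sum.neutral simp: power_0_left)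
  then show ?case
    using Suc by (simp add: algebra_simps)
qed simp

text \<open>
  Since \<open>B\<^sub>1(0) = -1/2\<close> is replaced by \<open>0\<close> in the periodic function, \<open>y\<close> becomes \<open>y + 1/2\<close> for \<open>r = 1\<close>; the
  factor 2 keeps the coefficients integral.
\<close>

definition hpoly_half :: "nat \<Rightarrow> 'a::comm_ring_1 \<Rightarrow> 'a \<Rightarrow> 'a" where
  "hpoly_half r z t = 2 * hpoly (r - 1) z t + (if r = 1 then t else 0)"

lemma hpoly_half_homogeneous:
  "r > 0 \<Longrightarrow> hpoly_half r (c * z) (c * t) = c ^ r * hpoly_half r z t"
  using hpoly_homogeneous[of "r - 1" c z t] by (simp add: hpoly_half_def algebra_simps)

lemma hpoly_half_hom:
  fixes f :: "'a::comm_ring_1 \<Rightarrow> 'b::comm_ring_1"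
  assumes add: "\<And>x y. f (x + y) = f x + f y" and mult: "\<And>x y. f (x * y) = f x * f y"
    and one: "f 1 = 1"
  shows "f (hpoly_half r z t) = hpoly_half r (f z) (f t)"
proof -
  have zero: "f 0 = 0"
    using add[of 0 0] by simp
  have "f (hpoly (r - 1) z t) = hpoly (r - 1) (f z) (f t)"
    by (rule hpoly_hom[of f, OF add mult one])
  moreover have "f 2 = 2"
    using add[of 1 1] unfolding one one_add_one .
  ultimately show ?thesis
    by (simp add: hpoly_half_def add mult zero)
qed

section \<open>Power series with controlled denominators\<close>

text \<open>
  The exponent \<open>m\<close> makes the bound supermultiplicative, so that the series below form a ring, while
  \<open>(m + 1)!\<close> still clears the denominators of \<open>(e\<^sup>u - 1) / u\<close> and hence those of its inverse.
\<close>

definition denom_bound :: "nat \<Rightarrow> int" where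
  "denom_bound m = fact (Suc m) ^ m"

lemma denom_bound_pos: "denom_bound m > 0"
  by (simp add: denom_bound_def)

lemma denom_bound_mult_dvd: "denom_bound m * denom_bound k dvd denom_bound (m + k)"
proof -
  have "(fact (Suc m) :: int) ^ m dvd fact (Suc (m + k)) ^ m"
    by (intro dvd_power_same fact_dvd) simp
  moreover have "(fact (Suc k) :: int) ^ k dvd fact (Suc (m + k)) ^ k"
    by (intro dvd_power_same fact_dvd) simp
  ultimately show ?thesis
    unfolding denom_bound_def power_add by (rule mult_dvd_mono)
qed

lemma prod_denom_bound_dvd: "finite A \<Longrightarrow> (\<Prod>i\<in>A. denom_bound (m i)) dvd denom_bound (\<Sum>i\<in>A. m i)"
proof (induction A rule: finite_induct)
  case (insert x A)
  then have "denom_bound (m x) * (\<Prod>i\<in>A. denom_bound (m i)) dvd denom_bound (m x) * denom_bound (\<Sum>i\<in>A. m i)"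
    by (intro mult_dvd_mono) auto
  also have "\<dots> dvd denom_bound (m x + (\<Sum>i\<in>A. m i))"
    by (rule denom_bound_mult_dvd)
  finally show ?case
    using insert by simp
qed (simp add: denom_bound_def)

text \<open>For \<open>q = 1\<close> these series form a ring, in which those for general
  \<open>q\<close> are the multiples of \<open>q\<close>; thus \<open>int_fps q (f - g)\<close> acts
  as a congruence modulo \<open>q\<close>.\<close>

definition int_fps :: "int \<Rightarrow> real fps \<Rightarrow> bool" where
  "int_fps q f \<longleftrightarrow> (\<forall>m. \<exists>i. of_int (denom_bound m) * fps_nth f m = of_int (q * i))"

lemma int_fpsD:
  assumes "int_fps q f"
  obtains i where "of_int (denom_bound m) * fps_nth f m = of_int (q * i)"
  using assms unfolding int_fps_def by blast

lemma int_fps_0 [simp]: "int_fps q 0"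
  unfolding int_fps_def by (metis fps_zero_nth mult_zero_right of_int_0)

lemma int_fpsI:
  assumes "\<And>m. of_int (denom_bound m) * fps_nth f m = of_int (q * i m)"
  shows "int_fps q f"
  using assms unfolding int_fps_def by blast

lemma int_fps_add:
  assumes "int_fps q f" "int_fps q g"
  shows "int_fps q (f + g)"
proof -
  obtain i j where "\<And>m. of_int (denom_bound m) * fps_nth f m = of_int (q * i m)"
    "\<And>m. of_int (denom_bound m) * fps_nth g m = of_int (q * j m)"
    using assms unfolding int_fps_def by metis
  then show ?thesis
    by (intro int_fpsI[of _ _ "\<lambda>m. i m + j m"]) (simp add: distrib_left)
qed

lemma int_fps_uminus:
  assumes "int_fps q f"
  shows "int_fps q (- f)"
proof -
  obtain i where "\<And>m. of_int (denom_bound m) * fps_nth f m = of_int (q * i m)"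
    using assms unfolding int_fps_def by metis
  then show ?thesis
    by (intro int_fpsI[of _ _ "\<lambda>m. - i m"]) simp
qed

lemma int_fps_diff: "int_fps q f \<Longrightarrow> int_fps q g \<Longrightarrow> int_fps q (f - g)"
  using int_fps_add[of q f "- g"] int_fps_uminus[of q g] by simp

lemma int_fps_sum: "(\<And>x. x \<in> A \<Longrightarrow> int_fps q (f x)) \<Longrightarrow> int_fps q (\<Sum>x\<in>A. f x)"
  by (induction A rule: infinite_finite_induct) (auto intro: int_fps_add)

text \<open>The product of the coefficients at \<open>k\<close> and \<open>m - k\<close> has
  denominator \<open>denom_bound k * denom_bound (m - k)\<close>, which divides
  \<open>denom_bound m\<close>.\<close>

lemma int_fps_mult:
  assumes "int_fps q f" "int_fps 1 g"
  shows "int_fps q (f * g)"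
  unfolding int_fps_def
proof
  fix m
  have "\<exists>i. of_int (denom_bound m) * (fps_nth f k * fps_nth g (m - k)) = (of_int (q * i) :: real)"
    if km: "k \<le> m" for k
  proof -
    obtain a where a: "of_int (denom_bound k) * fps_nth f k = of_int (q * a)"
      using assms(1) by (rule int_fpsD)
    obtain b where b: "of_int (denom_bound (m - k)) * fps_nth g (m - k) = of_int (1 * b)"
      using assms(2) by (rule int_fpsD)
    obtain c where "denom_bound m = denom_bound k * denom_bound (m - k) * c"
      using denom_bound_mult_dvd[of k "m - k"] unfolding le_add_diff_inverse[OF km] by (elim dvdE)
    then have "of_int (denom_bound m) * (fps_nth f k * fps_nth g (m - k))
        = (of_int (denom_bound k) * fps_nth f k) * (of_int (denom_bound (m - k)) * fps_nth g (m - k)) * of_int c"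
      by simp
    then show ?thesis
      unfolding a b by (intro exI[of _ "a * b * c"]) (simp add: mult_ac)
  qed
  then have "\<forall>k. \<exists>i. k \<le> m \<longrightarrow>
      of_int (denom_bound m) * (fps_nth f k * fps_nth g (m - k)) = (of_int (q * i) :: real)"
    by blast
  from choice[OF this] obtain i where i: "\<And>k. k \<le> m \<Longrightarrow>
      of_int (denom_bound m) * (fps_nth f k * fps_nth g (m - k)) = (of_int (q * i k) :: real)"
    by blast
  have "of_int (denom_bound m) * fps_nth (f * g) m = (\<Sum>k=0..m. of_int (q * i k))"
    unfolding fps_mult_nth sum_distrib_left by (intro sum.cong refl i) simp
  also have "\<dots> = of_int (q * (\<Sum>k=0..m. i k))"
    by (simp add: sum_distrib_left)
  finally show "\<exists>i. of_int (denom_bound m) * fps_nth (f * g) m = of_int (q * i)" ..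
qed

lemma int_fps_weaken: "int_fps q f \<Longrightarrow> int_fps 1 f"
  unfolding int_fps_def of_int_mult of_int_1 mult_1 by (metis of_int_mult)

lemma int_fps_const_mult:
  assumes "int_fps 1 f"
  shows "int_fps q (fps_const (of_int (q * c)) * f)"
proof -
  obtain i where "\<And>m. of_int (denom_bound m) * fps_nth f m = of_int (1 * i m)"
    using assms unfolding int_fps_def by metis
  then show ?thesis
    by (intro int_fpsI[of _ _ "\<lambda>m. c * i m"]) (simp add: mult_ac)
qed

lemma int_fps_of_int [simp]: "int_fps 1 (of_int c)"
proof -
  show ?thesis
    by (rule int_fpsI[of _ _ "\<lambda>m. if m = 0 then c else 0"]) (simp add: denom_bound_def fps_of_int[symmetric])
qed

lemma int_fps_of_nat [simp]: "int_fps 1 (of_nat c)"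
  using int_fps_of_int[of "int c"] by simp

lemma int_fps_1 [simp]: "int_fps 1 1"
  using int_fps_of_int[of 1] by simp

lemma int_fps_X [simp]: "int_fps 1 fps_X"
proof -
  show ?thesis
    by (rule int_fpsI[of _ _ "\<lambda>m. if m = 1 then denom_bound 1 else 0"]) simp
qed

lemma int_fps_power: "int_fps 1 f \<Longrightarrow> int_fps 1 (f ^ k)"
  by (induction k) (auto intro: int_fps_mult)

lemma int_fps_prod: "(\<And>x. x \<in> A \<Longrightarrow> int_fps 1 (f x)) \<Longrightarrow> int_fps 1 (\<Prod>x\<in>A. f x)"
  by (induction A rule: infinite_finite_induct) (auto intro: int_fps_mult)

text \<open>Covers series such as \<open>(exp (c X) - 1) / X\<close>. At \<open>m = 0\<close> the
  denominator is 1; for \<open>m > 0\<close> one of the \<open>m\<close> factors of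
  \<open>denom_bound m\<close> cancels it.\<close>

lemma int_fps_exp_shift:
  assumes "\<And>m. q dvd c m"
  shows "int_fps q (Abs_fps (\<lambda>m. of_int (c m) / fact (Suc m)))"
  unfolding int_fps_def
proof
  fix m
  obtain i where i: "c m = q * i"
    using assms by blast
  show "\<exists>i. of_int (denom_bound m) * fps_nth (Abs_fps (\<lambda>m. of_int (c m) / fact (Suc m))) m = (of_int (q * i) :: real)"
  proof (cases m)
    case 0
    then show ?thesis
      using i by (intro exI[of _ i]) (simp add: denom_bound_def)
  next
    case (Suc k)
    then have "of_int (denom_bound m) = fact (Suc m) * (of_int (fact (Suc m) ^ k) :: real)"
      by (simp add: denom_bound_def)
    then show ?thesis
      using i by (intro exI[of _ "i * fact (Suc m) ^ k"]) (simp del: fact_Suc)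
  qed
qed

lemma int_fps_exp [simp]: "int_fps 1 (fps_exp (of_int c))"
proof -
  have "int_fps 1 (1 + fps_X * Abs_fps (\<lambda>m. of_int (c ^ Suc m) / fact (Suc m)))"
    by (intro int_fps_add int_fps_mult int_fps_exp_shift) auto
  also have "1 + fps_X * Abs_fps (\<lambda>m. of_int (c ^ Suc m) / fact (Suc m)) = (fps_exp (of_int c) :: real fps)"
    by (rule fps_ext, rename_tac k, case_tac k) (simp_all del: fact_Suc)
  finally show ?thesis .
qed

text \<open>Since \<open>f\<close> has constant term 1, each coefficient of \<open>g\<close> follows
  from the earlier ones without division.\<close>

lemma int_fps_inverse:
  assumes "int_fps 1 f" "fps_nth f 0 = 1" "g * f = 1"
  shows "int_fps 1 g"
proof -
  have "\<exists>i. of_int (denom_bound m) * fps_nth g m = (of_int i :: real)" for m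
  proof (induction m rule: less_induct)
    case (less m)
    show ?case
    proof (cases m)
      case 0
      then show ?thesis
        using assms(2,3) by (metis denom_bound_def fps_mult_nth_0 fps_one_nth mult_1 mult_1_right of_int_1 power_0)
    next
      case (Suc l)
      \<comment> \<open>Truncating \<open>g\<close> below \<open>m\<close> makes closure under
        products available before the later coefficients are controlled.\<close>
      define g' where "g' = Abs_fps (\<lambda>k. if k < m then fps_nth g k else 0)"
      have "\<exists>i. of_int (denom_bound k) * fps_nth g' k = (of_int (1 * i) :: real)" for k
        using less[of k] by (cases "k < m") (auto simp: g'_def intro: exI[of _ 0])
      then have "int_fps 1 (g' * f)"
        using assms(1) by (intro int_fps_mult) (simp_all add: int_fps_def)
      then obtain i where i: "of_int (denom_bound m) * fps_nth (g' * f) m = (of_int (1 * i) :: real)"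
        by (rule int_fpsD)
      have "0 = fps_nth (g * f) m"
        using assms(3) Suc by simp
      also have "\<dots> = fps_nth g m + fps_nth (g' * f) m"
        using Suc assms(2) by (simp add: fps_mult_nth g'_def)
      finally have "fps_nth g m = - fps_nth (g' * f) m"
        by simp
      then have "of_int (denom_bound m) * fps_nth g m = of_int (- i)"
        using i by simp
      then show ?thesis ..
    qed
  qed
  then show ?thesis
    by (simp add: int_fps_def)
qed

lemma int_fps_hpoly:
  assumes z: "int_fps 1 z" and t: "int_fps 1 t"
  shows "int_fps 1 (hpoly s z t)"
proof (induction s rule: less_induct)
  case (less s)
  show ?case
  proof (cases s)
    case (Suc r)
    have "int_fps 1 (hpoly (r - j) z t)" for j
      using Suc by (intro less) simp
    then show ?thesis
      unfolding Suc hpoly.simps using z t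
      by (intro int_fps_mult int_fps_uminus int_fps_add int_fps_sum int_fps_power int_fps_of_nat)
  qed (simp add: z)
qed

text \<open>As an integer polynomial, \<open>hpoly\<close> respects congruences modulo
  \<open>q\<close>; the induction exchanges the two factors of the recursion one after the
  other.\<close>

lemma int_fps_hpoly_diff:
  assumes z: "int_fps 1 z" and w: "int_fps 1 w" and t: "int_fps 1 t" and q: "int_fps q (z - w)"
  shows "int_fps q (hpoly s z t - hpoly s w t)"
proof (induction s rule: less_induct)
  case (less s)
  show ?case
  proof (cases s)
    case (Suc r)
    let ?a = "\<lambda>z. \<Sum>j\<le>r. of_nat (Suc r choose Suc j) * hpoly (r - j) z t * t ^ j"
    have ih: "int_fps q (hpoly (r - j) z t - hpoly (r - j) w t)" for j
      using Suc by (intro less) simp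
    have "?a z - ?a w = (\<Sum>j\<le>r. (hpoly (r - j) z t - hpoly (r - j) w t)
        * (of_nat (Suc r choose Suc j) * t ^ j))"
      by (simp add: sum_subtractf[symmetric] algebra_simps)
    then have d: "int_fps q (?a z - ?a w)"
      using t by (auto intro!: int_fps_sum int_fps_mult[of q] ih int_fps_mult[of 1] int_fps_power
          simp del: binomial_Suc_Suc)
    have a: "int_fps 1 (?a z)"
      using z t by (intro int_fps_mult int_fps_sum int_fps_power int_fps_of_nat int_fps_hpoly)
    have "hpoly s z t - hpoly s w t = - ((z - w) * ?a z) - (?a z - ?a w) * (t + w)"
      unfolding Suc hpoly.simps by (simp add: algebra_simps)
    then show ?thesis
      using a d q t w by (auto intro!: int_fps_diff int_fps_uminus int_fps_mult[of q] int_fps_add)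
  qed (simp add: q)
qed

lemma int_fps_hpoly_half:
  "int_fps 1 z \<Longrightarrow> int_fps 1 t \<Longrightarrow> int_fps 1 (hpoly_half r z t)"
  unfolding hpoly_half_def
  using int_fps_of_int[of 2] by (auto intro!: int_fps_add int_fps_mult int_fps_hpoly)

lemma int_fps_hpoly_half_diff:
  assumes "int_fps 1 z" "int_fps 1 w" "int_fps 1 t" "int_fps q (z - w)"
  shows "int_fps q (hpoly_half r z t - hpoly_half r w t)"
proof -
  have "hpoly_half r z t - hpoly_half r w t = (hpoly (r - 1) z t - hpoly (r - 1) w t) * of_int 2"
    by (simp add: hpoly_half_def algebra_simps)
  then show ?thesis
    using assms by (metis int_fps_mult int_fps_hpoly_diff int_fps_of_int)
qed

lemma int_fps_prod_diff:
  assumes "finite A" "\<And>x. x \<in> A \<Longrightarrow> int_fps 1 (f x)" "\<And>x. x \<in> A \<Longrightarrow> int_fps 1 (g x)"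
    "\<And>x. x \<in> A \<Longrightarrow> int_fps q (f x - g x)"
  shows "int_fps q ((\<Prod>x\<in>A. f x) - (\<Prod>x\<in>A. g x))"
  using assms
proof (induction A rule: finite_induct)
  case (insert x A)
  have "(\<Prod>x\<in>insert x A. f x) - (\<Prod>x\<in>insert x A. g x)
      = (f x - g x) * (\<Prod>x\<in>A. f x) + ((\<Prod>x\<in>A. f x) - (\<Prod>x\<in>A. g x)) * g x"
    using insert by (simp add: algebra_simps)
  then show ?case
    using insert by (auto intro!: int_fps_add int_fps_mult[of q] int_fps_prod)
qed simp

section \<open>Bernoulli numbers and finite Fourier transforms\<close>

abbreviation bgf :: "real fps" where
  "bgf \<equiv> bernoulli_gf 0"

lemma bgf_mult_exp: "bgf * (fps_exp 1 - 1) = fps_X"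
  using bernoulli_gf_times[of 0] by simp

text \<open>Cancelling \<open>X\<close> from \<open>exp X - 1\<close> leaves a series with constant
  term 1, so that \<open>int_fps_inverse\<close> applies to \<open>bgf\<close>.\<close>

lemma bgf_mult_unit: "bgf * Abs_fps (\<lambda>m. of_int 1 / fact (Suc m)) = 1"
proof -
  have "fps_exp 1 - 1 = fps_X * Abs_fps (\<lambda>m. of_int 1 / fact (Suc m) :: real)"
    by (rule fps_ext, rename_tac k, case_tac k) (simp_all del: fact_Suc)
  with bgf_mult_exp have "fps_X * (bgf * Abs_fps (\<lambda>m. of_int 1 / fact (Suc m))) = fps_X * 1"
    by (simp add: mult_ac)
  then show ?thesis
    by (subst (asm) mult_cancel_left) simp
qed

lemma int_fps_bgf: "int_fps 1 bgf"
  by (rule int_fps_inverse[OF _ _ bgf_mult_unit]) (rule int_fps_exp_shift, simp_all)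

lemma bgf_nth_0 [simp]: "fps_nth bgf 0 = 1"
  using arg_cong[OF bgf_mult_unit, of "\<lambda>f. fps_nth f 0"] by (simp add: fps_mult_nth)

lemma bgf_nth_1 [simp]: "fps_nth bgf (Suc 0) = - 1 / 2"
  using arg_cong[OF bgf_mult_unit, of "\<lambda>f. fps_nth f 1"] by (simp add: fps_mult_nth)

text \<open>Substituting \<open>-X\<close> gives \<open>bgf(-X) = bgf(X) + X\<close>, so every odd
  coefficient beyond degree 1 equals its negative.\<close>

lemma bgf_nth_odd:
  assumes "odd m" "m \<noteq> 1"
  shows "fps_nth bgf m = 0"
proof -
  define g where "g = bgf oo (fps_const (- 1) * fps_X)"
  have "g * (fps_exp (- 1) - 1) = - fps_X"
    using arg_cong[OF bgf_mult_exp, of "\<lambda>f. f oo (fps_const (- 1) * fps_X)"]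
    by (simp add: fps_compose_mult_distrib fps_compose_sub_distrib g_def flip: fps_const_neg)
  then have "g * ((fps_exp (- 1) - 1) * fps_exp 1) = - fps_X * fps_exp 1"
    by (simp flip: mult.assoc)
  moreover have "(fps_exp (- 1) - 1) * fps_exp 1 = (1 - fps_exp 1 :: real fps)"
    by (simp add: left_diff_distrib flip: fps_exp_add_mult)
  ultimately have "g * (fps_exp 1 - 1) = fps_X * fps_exp 1"
    by (simp add: algebra_simps)
  also have "\<dots> = (bgf + fps_X) * (fps_exp 1 - 1)"
    using bgf_mult_exp by (simp add: algebra_simps)
  finally have "g = bgf + fps_X"
    by simp
  then have "fps_nth g m = fps_nth (bgf + fps_X) m"
    by simp
  then show ?thesis
    using assms by (simp add: g_def)
qed

text \<open>The value 0 at \<open>m = 1\<close> matches the first periodic Bernoulli function at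
  integers and makes all odd coefficients vanish.\<close>

definition bcoeff :: "nat \<Rightarrow> real" where
  "bcoeff m = (if m = 1 then 0 else fps_nth bgf m)"

lemma bcoeff_odd: "odd m \<Longrightarrow> bcoeff m = 0"
  by (auto simp: bcoeff_def bgf_nth_odd)

lemma bcoeff_even: "even m \<Longrightarrow> bcoeff m = bernoulli_number m / fact m"
  by (auto simp: bcoeff_def bernoulli_number_def bernoulli_poly_def)

lemma bcoeff_int: "\<exists>i. of_int (denom_bound m) * bcoeff m = of_int i"
proof (cases "m = 1")
  case False
  then show ?thesis
    using int_fps_bgf[unfolded int_fps_def] by (simp add: bcoeff_def)
qed (auto simp: bcoeff_def intro: exI[of _ 0])

text \<open>
  The right-hand side is \<open>u\<^sup>s\<^sup>+\<^sup>1\<close> times the \<open>s\<close>-th derivative of \<open>1 / (e\<^sup>u - 1)\<close>; the recursion is Leibniz'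
  rule for \<open>(e\<^sup>u - 1) \<cdot> 1 / (e\<^sup>u - 1) = 1\<close>.
\<close>

lemma hpoly_bgf:
  "hpoly s bgf fps_X = Abs_fps (\<lambda>m. fact s * fps_nth bgf m * ((of_nat m - 1) gchoose s))"
proof -
  define f where "f s = Abs_fps (\<lambda>m. fact s * fps_nth bgf m * ((of_nat m - 1) gchoose s))"
    for s
  \<comment> \<open>By Leibniz' rule, \<open>exp X * T s\<close> is \<open>X^(s + 1)\<close> times
    the \<open>s\<close>-th derivative of \<open>exp X / (exp X - 1)\<close>.\<close>
  define T where "T s = (\<Sum>j\<le>s. of_nat (s choose j) * f (s - j) * fps_X ^ j)" for s
  have f_Suc: "f (Suc s) = fps_X * fps_deriv (f s) - of_nat (Suc s) * f s" for s
  proof (rule fps_ext)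
    fix m
    have "of_nat (Suc s) * ((of_nat m - 1) gchoose Suc s)
        = (of_nat m - 1 - of_nat s) * ((of_nat m - 1 :: real) gchoose s)"
      using gbinomial_mult_1[of "of_nat m - 1 :: real" s] by (simp add: algebra_simps)
    then have "fps_nth (f (Suc s)) m
        = fact s * fps_nth bgf m * ((of_nat m - 1 - of_nat s) * ((of_nat m - 1) gchoose s))"
      by (simp add: f_def mult_ac)
    also have "\<dots> = fps_nth (fps_X * fps_deriv (f s) - of_nat (Suc s) * f s) m"
      by (cases m) (simp_all add: f_def algebra_simps flip: fps_of_nat)
    finally show "fps_nth (f (Suc s)) m
        = fps_nth (fps_X * fps_deriv (f s) - of_nat (Suc s) * f s) m" .
  qed
  have T_Suc: "T (Suc s) = fps_X * fps_deriv (T s) - of_nat (Suc s) * T s + fps_X * T s" for s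
  proof -
    have d: "fps_X * fps_deriv (of_nat c * f (s - j) * fps_X ^ j)
        = of_nat c * f (Suc s - j) * fps_X ^ j + of_nat (Suc s) * (of_nat c * f (s - j) * fps_X ^ j)"
      if "j \<le> s" for c j
    proof -
      have "fps_X * fps_deriv (of_nat c * f (s - j) * fps_X ^ j)
        = of_nat c * (fps_X * fps_deriv (f (s - j))) * fps_X ^ j
        + of_nat c * f (s - j) * (fps_X * fps_deriv (fps_X ^ j))"
        by (simp add: algebra_simps flip: fps_of_nat)
      also have "fps_X * fps_deriv (fps_X ^ j) = of_nat j * (fps_X ^ j :: real fps)"
        by (induction j) (simp_all add: algebra_simps)
      also have "fps_X * fps_deriv (f (s - j)) = f (Suc s - j) + of_nat (Suc (s - j)) * f (s - j)"
        using f_Suc[of "s - j"] that by (simp add: Suc_diff_le)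
      also have "of_nat (Suc (s - j)) = (of_nat (Suc s) - of_nat j :: real fps)"
        using that by (simp add: of_nat_diff)
      finally show ?thesis
        by (simp add: algebra_simps)
    qed
    have "fps_X * fps_deriv (T s)
        = (\<Sum>j\<le>s. of_nat (s choose j) * f (Suc s - j) * fps_X ^ j) + of_nat (Suc s) * T s"
      unfolding T_def fps_deriv_sum sum_distrib_left sum.distrib[symmetric]
      by (intro sum.cong refl d) simp
    moreover have "T (Suc s) = (\<Sum>j\<le>s. of_nat (s choose j) * f (Suc s - j) * fps_X ^ j) + fps_X * T s"
    proof -
      have "T (Suc s) = f (Suc s)
          + (\<Sum>j\<le>s. of_nat (Suc s choose Suc j) * f (s - j) * fps_X ^ Suc j)"
        unfolding T_def sum.atMost_Suc_shift[of _ s] by simp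
      also have "(\<Sum>j\<le>s. of_nat (Suc s choose Suc j) * f (s - j) * fps_X ^ Suc j)
          = (\<Sum>j\<le>s. of_nat (s choose Suc j) * f (s - j) * fps_X ^ Suc j) + fps_X * T s"
        by (simp add: T_def sum_distrib_left algebra_simps sum.distrib[symmetric])
      also have "f (Suc s) + ((\<Sum>j\<le>s. of_nat (s choose Suc j) * f (s - j) * fps_X ^ Suc j)
            + fps_X * T s)
          = (\<Sum>j\<le>Suc s. of_nat (s choose j) * f (Suc s - j) * fps_X ^ j) + fps_X * T s"
        unfolding sum.atMost_Suc_shift[of _ s] by simp
      finally show ?thesis
        by simp
    qed
    ultimately show ?thesis
      by simp
  qed
  have exp_bgf: "fps_exp 1 * bgf = bgf + fps_X"
    using bgf_mult_exp by (simp add: algebra_simps)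
  have f0: "f 0 = bgf"
    by (simp add: f_def fps_eq_iff)
  \<comment> \<open>Since \<open>exp X / (exp X - 1) = 1 + 1 / (exp X - 1)\<close>, the derivatives
    of the two quotients differ only for \<open>s = 0\<close>.\<close>
  have T: "fps_exp 1 * T s = f s + (if s = 0 then fps_X else 0)" for s
  proof (induction s)
    case 0
    show ?case
      using exp_bgf by (simp add: T_def f0)
  next
    case (Suc s)
    have "fps_exp 1 * T (Suc s)
        = fps_X * fps_deriv (fps_exp 1 * T s) - of_nat (Suc s) * (fps_exp 1 * T s)"
      unfolding T_Suc by (simp add: algebra_simps)
    also have "\<dots> = f (Suc s)"
      unfolding Suc f_Suc by (simp add: algebra_simps)
    finally show ?case
      by simp
  qed
  have "hpoly s bgf fps_X = f s"
  proof (rule hpoly_unique[of f])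
    show "f 0 = bgf"
      by (rule f0)
  next
    fix s
    let ?S = "\<Sum>j\<le>s. of_nat (Suc s choose Suc j) * f (s - j) * fps_X ^ j"
    have "T (Suc s) = f (Suc s) + fps_X * ?S"
      unfolding T_def sum.atMost_Suc_shift[of _ s] sum_distrib_left by (simp add: mult_ac)
    with T[of "Suc s"] have e: "(fps_exp 1 - 1) * f (Suc s) = - fps_exp 1 * (fps_X * ?S)"
      by (simp add: algebra_simps)
    have "fps_X * f (Suc s) = bgf * ((fps_exp 1 - 1) * f (Suc s))"
      by (simp add: bgf_mult_exp flip: mult.assoc)
    also have "\<dots> = - (fps_exp 1 * bgf) * (fps_X * ?S)"
      unfolding e by (simp only: mult_ac mult_minus_left mult_minus_right)
    also have "\<dots> = fps_X * (- (fps_X + bgf) * ?S)"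
      unfolding exp_bgf by (simp only: mult_ac mult_minus_left mult_minus_right add_ac)
    finally show "f (Suc s) = - (fps_X + bgf) * ?S"
      by (subst (asm) mult_cancel_left) simp
  qed
  then show ?thesis
    by (simp add: f_def)
qed

text \<open>At \<open>m = 1\<close> the correction cancels \<open>2 * (- 1 / 2)\<close> if
  \<open>r = 1\<close>, and the binomial coefficient vanishes for larger \<open>r\<close>. Hence
  \<open>bcoeff\<close> may replace the coefficients of \<open>bgf\<close>.\<close>

lemma hpoly_half_bgf:
  assumes "r > 0"
  shows "fps_nth (hpoly_half r bgf fps_X) m
    = 2 * fact (r - 1) * bcoeff m * ((of_nat m - 1) gchoose (r - 1))"
proof -
  have "fps_nth (hpoly_half r bgf fps_X) m
      = 2 * (fact (r - 1) * fps_nth bgf m * ((of_nat m - 1) gchoose (r - 1)))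
        + (if r = 1 \<and> m = 1 then 1 else 0)"
    unfolding hpoly_half_def hpoly_bgf
    by (auto simp: fps_numeral_fps_const)
  moreover have "((0::real) gchoose (r - 1)) = 0" if "r \<noteq> 1"
    using that assms gbinomial_0[of "r - 2"] by (cases r; cases "r - 1") auto
  ultimately show ?thesis
    by (auto simp: bcoeff_def)
qed

lemma hpoly_half_compose_bgf:
  "hpoly_half r (bgf oo (fps_const c * fps_X)) (fps_const c * fps_X)
    = hpoly_half r bgf fps_X oo (fps_const c * fps_X)"
  by (subst hpoly_half_hom[of "\<lambda>f. f oo (fps_const c * fps_X)"])
    (simp_all add: fps_compose_add_distrib fps_compose_mult_distrib)

section \<open>Fourier transforms of the Bernoulli polynomials at the fractions k/q\<close>

definition complex_fps :: "real fps \<Rightarrow> complex fps" where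
  "complex_fps f = Abs_fps (\<lambda>n. of_real (fps_nth f n))"

lemma complex_fps_nth [simp]: "fps_nth (complex_fps f) n = of_real (fps_nth f n)"
  by (simp add: complex_fps_def)

lemma complex_fps_mult: "complex_fps (f * g) = complex_fps f * complex_fps g"
  by (rule fps_ext) (simp add: fps_mult_nth)

lemma complex_fps_diff: "complex_fps (f - g) = complex_fps f - complex_fps g"
  by (rule fps_ext) simp

lemma complex_fps_1: "complex_fps 1 = 1"
  by (rule fps_ext) simp

lemma complex_fps_X: "complex_fps fps_X = fps_X"
  by (rule fps_ext) simp

lemma complex_fps_const: "complex_fps (fps_const c) = fps_const (of_real c)"
  by (rule fps_ext) simp

lemma complex_fps_exp: "complex_fps (fps_exp c) = fps_exp (of_real c)"
  by (rule fps_ext) simp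

text \<open>For \<open>q > 0\<close> this is \<open>q X exp (k X) / (exp (q X) - 1)\<close>, with
  the same denominator for all \<open>k\<close>.\<close>

definition scaled_bgf :: "nat \<Rightarrow> nat \<Rightarrow> real fps" where
  "scaled_bgf q k = bernoulli_gf (real k / real q) oo (fps_const (real q) * fps_X)"

lemma scaled_bgf_nth:
  "fps_nth (scaled_bgf q k) m = real q ^ m * fps_nth (bernoulli_gf (real k / real q)) m"
  by (simp add: scaled_bgf_def)

lemma scaled_bgf_mult_exp:
  assumes "q > 0"
  shows "scaled_bgf q k * (fps_exp (real q) - 1)
    = fps_const (real q) * fps_X * fps_exp (real k)"
  using arg_cong[OF bernoulli_gf_times[of "real k / real q"],
      of "\<lambda>f. f oo (fps_const (real q) * fps_X)"] assms
  by (simp add: scaled_bgf_def fps_compose_mult_distrib fps_compose_sub_distrib)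

text \<open>The sum of the powers of \<open>x exp X\<close> is geometric, and
  \<open>x ^ q = 1\<close> turns its numerator into \<open>exp (q X) - 1\<close>, which cancels the
  common denominator.\<close>

lemma twisted_sum_scaled_bgf:
  fixes x :: complex
  assumes q: "q > 0" and x: "x ^ q = 1"
  shows "(fps_const x * fps_exp 1 - 1) * (\<Sum>k<q. fps_const (x ^ k) * complex_fps (scaled_bgf q k))
    = fps_const (of_nat q) * fps_X"
proof -
  let ?e = "fps_exp (of_nat q) - 1 :: complex fps"
  let ?g = "\<lambda>k. fps_const (x ^ k) * fps_exp (of_nat k)"
  have "complex_fps (scaled_bgf q k) * ?e = fps_const (of_nat q) * fps_X * fps_exp (of_nat k)" for k
    using arg_cong[OF scaled_bgf_mult_exp[OF q], of complex_fps]
    by (simp add: complex_fps_mult complex_fps_diff complex_fps_1 complex_fps_X complex_fps_const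
        complex_fps_exp)
  then have F: "(\<Sum>k<q. fps_const (x ^ k) * complex_fps (scaled_bgf q k)) * ?e
      = fps_const (of_nat q) * fps_X * (\<Sum>k<q. ?g k)"
    unfolding sum_distrib_left sum_distrib_right by (intro sum.cong refl) (simp add: mult_ac)
  have G: "(fps_const x * fps_exp 1 - 1) * (\<Sum>k<q. ?g k) = ?e"
  proof -
    have "(fps_const x * fps_exp 1) * ?g k = ?g (Suc k)" for k
    proof -
      have "fps_exp 1 * fps_exp (of_nat k) = (fps_exp (of_nat (Suc k)) :: complex fps)"
        by (simp flip: fps_exp_add_mult)
      moreover have "fps_const x * fps_const (x ^ k) = fps_const (x ^ Suc k)"
        by simp
      ultimately show ?thesis
        by (metis mult.assoc mult.left_commute)
    qed
    then have "(fps_const x * fps_exp 1 - 1) * (\<Sum>k<q. ?g k) = (\<Sum>k<q. ?g (Suc k) - ?g k)"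
      unfolding sum_distrib_left left_diff_distrib by simp
    also have "\<dots> = ?g q - ?g 0"
      by (rule sum_lessThan_telescope)
    finally show ?thesis
      by (simp add: x)
  qed
  have "((fps_const x * fps_exp 1 - 1)
        * (\<Sum>k<q. fps_const (x ^ k) * complex_fps (scaled_bgf q k))) * ?e
      = (fps_const (of_nat q) * fps_X) * ((fps_const x * fps_exp 1 - 1) * (\<Sum>k<q. ?g k))"
    unfolding mult.assoc F by (simp only: mult_ac)
  also note G
  finally have "((fps_const x * fps_exp 1 - 1)
        * (\<Sum>k<q. fps_const (x ^ k) * complex_fps (scaled_bgf q k))) * ?e
      = (fps_const (of_nat q) * fps_X) * ?e" .
  moreover have "?e \<noteq> 0"
    using q by simp
  ultimately show ?thesis
    by (subst (asm) mult_cancel_right) simp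
qed

text \<open>The scaling makes this the coefficient of \<open>X^s\<close> in
  \<open>1 / (x exp X - 1)\<close> when \<open>x ^ q = 1\<close> and \<open>x \<noteq> 1\<close>;
  the index \<open>Suc s\<close> accounts for the factor \<open>X\<close> of the generating
  function.\<close>

definition bernoulli_fourier :: "nat \<Rightarrow> nat \<Rightarrow> complex \<Rightarrow> complex" where
  "bernoulli_fourier q s x
    = (\<Sum>k<q. of_real (real q ^ s * fps_nth (bernoulli_gf (real k / real q)) (Suc s)) * x ^ k)"

lemma bernoulli_fourier_eq_nth:
  "of_nat q * bernoulli_fourier q s x
    = fps_nth (\<Sum>k<q. fps_const (x ^ k) * complex_fps (scaled_bgf q k)) (Suc s)"
  unfolding bernoulli_fourier_def fps_sum_nth sum_distrib_left
  by (intro sum.cong refl) (simp add: scaled_bgf_nth mult_ac)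

text \<open>At \<open>x = 1\<close> the twisted sum is \<open>q * bgf\<close>; this is the
  multiplication formula of the Bernoulli polynomials at 0.\<close>

lemma bernoulli_fourier_1:
  assumes "q > 0"
  shows "bernoulli_fourier q s 1 = of_real (fps_nth bgf (Suc s))"
proof -
  let ?F = "\<Sum>k<q. fps_const (1 ^ k) * complex_fps (scaled_bgf q k)"
  have b: "complex_fps bgf * (fps_exp 1 - 1) = fps_X"
    using arg_cong[OF bgf_mult_exp, of complex_fps]
    by (simp add: complex_fps_mult complex_fps_diff complex_fps_1 complex_fps_X complex_fps_exp)
  have "(fps_exp 1 - 1) * ?F = fps_const (of_nat q) * fps_X"
    using twisted_sum_scaled_bgf[OF assms, of 1] by simp
  also have "\<dots> = (fps_exp 1 - 1) * (fps_const (of_nat q) * complex_fps bgf)"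
    by (subst b[symmetric]) (simp add: mult_ac)
  finally have "?F = fps_const (of_nat q) * complex_fps bgf"
    by (subst (asm) mult_cancel_left) simp
  then have "of_nat q * bernoulli_fourier q s 1 = of_nat q * of_real (fps_nth bgf (Suc s))"
    unfolding bernoulli_fourier_eq_nth by simp
  then show ?thesis
    using assms by simp
qed

text \<open>Comparing coefficients in \<open>(x exp X - 1) F = q X\<close> gives the recursion of
  \<open>hpoly\<close>, with \<open>x / (x - 1) = 1 + 1 / (x - 1)\<close> in the role of
  \<open>t + z\<close>.\<close>

lemma bernoulli_fourier_hpoly:
  assumes q: "q > 0" and x: "x ^ q = 1" "x \<noteq> 1"
  shows "fact s * bernoulli_fourier q s x = hpoly s (1 / (x - 1)) 1"
proof -
  define F where "F = (\<Sum>k<q. fps_const (x ^ k) * complex_fps (scaled_bgf q k))"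
  define b where "b s = bernoulli_fourier q s x" for s
  have F_Suc: "fps_nth F (Suc s) = of_nat q * b s" for s
    by (simp add: b_def bernoulli_fourier_eq_nth F_def)
  have eq: "fps_const x * (fps_exp 1 * F) - F = fps_const (of_nat q) * fps_X"
    using twisted_sum_scaled_bgf[OF q x(1)] by (simp add: F_def algebra_simps)
  \<comment> \<open>As the constant term vanishes, the convolutions below involve only the values
    \<open>b\<close>.\<close>
  have F0: "fps_nth F 0 = 0"
    using arg_cong[OF eq, of "\<lambda>f. fps_nth f 0"] x(2) by simp
  have rec: "x * (b s + (\<Sum>j<s. b (s - Suc j) / fact (Suc j))) - b s = (if s = 0 then 1 else 0)" for s
  proof -
    have "fps_nth (fps_exp 1 * F) (Suc s) = of_nat q * (\<Sum>j\<le>s. b (s - j) / fact j)"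
      unfolding fps_mult_nth atLeast0AtMost sum.atMost_Suc sum_distrib_left
      by (auto simp add: F0 F_Suc Suc_diff_le intro!: sum.cong)
    also have "(\<Sum>j\<le>s. b (s - j) / fact j) = b s + (\<Sum>j<s. b (s - Suc j) / fact (Suc j))"
      unfolding lessThan_Suc_atMost[symmetric] sum.lessThan_Suc_shift by simp
    finally have nth: "fps_nth (fps_exp 1 * F) (Suc s)
        = of_nat q * (b s + (\<Sum>j<s. b (s - Suc j) / fact (Suc j)))" .
    have "x * fps_nth (fps_exp 1 * F) (Suc s) - fps_nth F (Suc s) = of_nat q * (if s = 0 then 1 else 0)"
      using arg_cong[OF eq, of "\<lambda>f. fps_nth f (Suc s)"] by simp
    then have "of_nat q * (x * (b s + (\<Sum>j<s. b (s - Suc j) / fact (Suc j))) - b s)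
        = of_nat q * (if s = 0 then 1 else 0)"
      unfolding nth F_Suc by (simp only: right_diff_distrib mult.left_commute)
    then show ?thesis
      using q by (subst (asm) mult_cancel_left) simp
  qed
  have "hpoly s (1 / (x - 1)) 1 = fact s * b s"
  proof (rule hpoly_unique[of "\<lambda>s. fact s * b s"])
    show "fact 0 * b 0 = 1 / (x - 1)"
      using rec[of 0] x(2) by (simp add: field_simps)
  next
    fix s
    have "(\<Sum>j\<le>s. of_nat (Suc s choose Suc j) * (fact (s - j) * b (s - j)) * 1 ^ j)
        = fact (Suc s) * (\<Sum>j<Suc s. b (Suc s - Suc j) / fact (Suc j))"
      unfolding sum_distrib_left lessThan_Suc_atMost
    proof (intro sum.cong refl)
      fix j assume "j \<in> {..s}"
      then have "of_nat (Suc s choose Suc j) = (fact (Suc s) / (fact (Suc j) * fact (s - j)) :: complex)"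
        by (subst binomial_fact) auto
      then show "of_nat (Suc s choose Suc j) * (fact (s - j) * b (s - j)) * 1 ^ j
          = fact (Suc s) * (b (Suc s - Suc j) / fact (Suc j))"
        by (simp del: fact_Suc)
    qed
    moreover have "b (Suc s) = - (1 + 1 / (x - 1)) * (\<Sum>j<Suc s. b (Suc s - Suc j) / fact (Suc j))"
      using rec[of "Suc s"] x(2) by (simp add: field_simps del: sum.lessThan_Suc fact_Suc)
    ultimately show "fact (Suc s) * b (Suc s) = - (1 + 1 / (x - 1))
        * (\<Sum>j\<le>s. of_nat (Suc s choose Suc j) * (fact (s - j) * b (s - j)) * 1 ^ j)"
      by (simp only: mult_ac)
  qed
  then show ?thesis
    by (simp add: b_def)
qed

section \<open>Sums over roots of unity\<close>

text \<open>Integer coefficients allow the same polynomial to be evaluated at roots of unity and at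
  the series \<open>exp X\<close>.\<close>

definition eval_at :: "'a::comm_ring_1 \<Rightarrow> int poly \<Rightarrow> 'a" where
  "eval_at x h = poly (map_poly of_int h) x"

lemma eval_at_pCons [simp]: "eval_at x (pCons a h) = of_int a + x * eval_at x h"
  by (simp add: eval_at_def map_poly_pCons)

lemma eval_at_0 [simp]: "eval_at x 0 = 0"
  by (simp add: eval_at_def)

lemma eval_at_1 [simp]: "eval_at x 1 = 1"
  by (simp add: eval_at_def)

lemma eval_at_add: "eval_at x (g + h) = eval_at x g + eval_at x h"
  by (induction g h rule: poly_induct2) (simp_all add: algebra_simps)

lemma eval_at_smult: "eval_at x (smult a h) = of_int a * eval_at x h"
  by (induction h) (simp_all add: algebra_simps)

lemma eval_at_mult: "eval_at x (g * h) = eval_at x g * eval_at x h"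
  by (induction g) (simp_all add: eval_at_add eval_at_smult algebra_simps)

lemma eval_at_power: "eval_at x (h ^ k) = eval_at x h ^ k"
  by (induction k) (simp_all add: eval_at_mult)

lemma eval_at_sum: "eval_at x (\<Sum>i\<in>A. h i) = (\<Sum>i\<in>A. eval_at x (h i))"
  by (induction A rule: infinite_finite_induct) (simp_all add: eval_at_add)

lemma eval_at_prod: "eval_at x (\<Prod>i\<in>A. h i) = (\<Prod>i\<in>A. eval_at x (h i))"
  by (induction A rule: infinite_finite_induct) (simp_all add: eval_at_mult)

lemma eval_at_hpoly: "eval_at x (hpoly s z t) = hpoly s (eval_at x z) (eval_at x t)"
  by (rule hpoly_hom) (simp_all add: eval_at_add eval_at_mult)

lemma eval_at_hpoly_half: "eval_at x (hpoly_half r z t) = hpoly_half r (eval_at x z) (eval_at x t)"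
  by (rule hpoly_half_hom) (simp_all add: eval_at_add eval_at_mult)

lemma eval_at_altdef: "eval_at x h = (\<Sum>i\<le>degree h. of_int (coeff h i) * x ^ i)"
proof -
  have "eval_at x h = eval_at x (\<Sum>i\<le>degree h. monom (coeff h i) i)"
    by (simp add: poly_as_sum_of_monoms)
  also have "\<dots> = (\<Sum>i\<le>degree h. eval_at x (smult (coeff h i) ([:0, 1:] ^ i)))"
    unfolding eval_at_sum by (simp add: monom_altdef)
  finally show ?thesis
    by (simp add: eval_at_smult eval_at_power)
qed

lemma eval_at_exp_nth_0: "fps_nth (eval_at (fps_exp (1::real)) h) 0 = of_int (poly h 1)"
  by (induction h) (simp_all add: fps_of_int[symmetric])

section \<open>Additive characters modulo q\<close>

definition chi :: "nat \<Rightarrow> int \<Rightarrow> complex" where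
  "chi q x = cis (2 * pi * of_int x / of_nat q)"

lemma chi_0 [simp]: "chi q 0 = 1"
  by (simp add: chi_def)

lemma chi_add: "chi q (x + y) = chi q x * chi q y"
  by (simp add: chi_def cis_mult add_divide_distrib ring_distribs)

lemma chi_power: "chi q x ^ k = chi q (x * int k)"
  by (simp add: chi_def DeMoivre mult_ac)

lemma chi_sum: "chi q (\<Sum>i\<in>A. f i) = (\<Prod>i\<in>A. chi q (f i))"
  by (induction A rule: infinite_finite_induct) (simp_all add: chi_add)

lemma chi_eq_1_iff:
  assumes "q > 0"
  shows "chi q x = 1 \<longleftrightarrow> int q dvd x"
proof
  assume "chi q x = 1"
  then have "cos (2 * pi * of_int x / of_nat q) = 1"
    by (simp add: chi_def complex_eq_iff)
  then obtain k :: int where "2 * pi * of_int x / of_nat q = of_int k * 2 * pi"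
    using cos_one_2pi_int by blast
  then have "of_int x = (of_int (k * int q) :: real)"
    using assms by (simp add: field_simps)
  then have "x = k * int q"
    by (simp only: of_int_eq_iff)
  then show "int q dvd x"
    by simp
next
  assume "int q dvd x"
  then obtain k where "x = int q * k"
    by (elim dvdE)
  then show "chi q x = 1"
    using assms cis_multiple_2pi[of "of_int k"] by (simp add: chi_def mult_ac)
qed

lemma chi_power_q: "q > 0 \<Longrightarrow> chi q x ^ q = 1"
  by (simp add: chi_power chi_eq_1_iff)

lemma chi_cong: "q > 0 \<Longrightarrow> [x = y] (mod int q) \<Longrightarrow> chi q x = chi q y"
  using chi_add[of q "x - y" y] chi_eq_1_iff[of q "x - y"]
  by (simp add: cong_iff_dvd_diff)

lemma sum_chi:
  assumes "q > 0"
  shows "(\<Sum>j<q. chi q (int j * x)) = (if int q dvd x then of_nat q else 0)"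
proof -
  have "(\<Sum>j<q. chi q (int j * x)) = (\<Sum>j<q. chi q x ^ j)"
    by (simp add: chi_power mult.commute)
  also have "\<dots> = (if int q dvd x then of_nat q else 0)"
    using assms chi_eq_1_iff[OF assms, of x]
    by (auto simp: geometric_sum chi_power_q)
  finally show ?thesis .
qed

text \<open>
  For \<open>G = h / (x - 1)\<^sup>M\<close> this is the sum of \<open>G(\<zeta>)\<close> over the roots of unity \<open>\<zeta> \<noteq> 1\<close> plus the constant
  term of \<open>G(e\<^sup>u)\<close>.
\<close>

definition root_residue_sum :: "nat \<Rightarrow> nat \<Rightarrow> int poly \<Rightarrow> complex" where
  "root_residue_sum q M h
    = (\<Sum>j=1..<q. eval_at (chi q (int j)) h / (chi q (int j) - 1) ^ M)
      + of_real (fps_nth (eval_at (fps_exp 1) h * bgf ^ M) M)"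

lemma root_residue_sum_add:
  "root_residue_sum q M (g + h) = root_residue_sum q M g + root_residue_sum q M h"
  by (simp add: root_residue_sum_def eval_at_add sum.distrib add_divide_distrib distrib_right)

lemma root_residue_sum_smult:
  "root_residue_sum q M (smult a h) = of_int a * root_residue_sum q M h"
  by (simp add: root_residue_sum_def eval_at_smult sum_distrib_left distrib_left mult.assoc
      flip: fps_of_int)

lemma chi_neq_1: "j \<in> {1..<q} \<Longrightarrow> chi q (int j) \<noteq> 1"
  by (auto simp: chi_eq_1_iff dest: zdvd_imp_le)

text \<open>The factor \<open>x - 1\<close> cancels in the fractions; in the series,
  \<open>bgf * (exp X - 1) = X\<close> shifts the extracted coefficient by one.\<close>

lemma root_residue_sum_Suc:
  "root_residue_sum q (Suc M) ([:- 1, 1:] * h) = root_residue_sum q M h"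
proof -
  have "eval_at (fps_exp 1) ([:- 1, 1:] * h) * bgf ^ Suc M
      = (bgf * (fps_exp 1 - 1)) * (eval_at (fps_exp 1) h * bgf ^ M)"
    unfolding eval_at_mult by simp
  then have "fps_nth (eval_at (fps_exp 1) ([:- 1, 1:] * h) * bgf ^ Suc M) (Suc M)
      = fps_nth (fps_X * (eval_at (fps_exp 1) h * bgf ^ M)) (Suc M)"
    by (simp only: bgf_mult_exp)
  then have "fps_nth (eval_at (fps_exp 1) ([:- 1, 1:] * h) * bgf ^ Suc M) (Suc M)
      = fps_nth (eval_at (fps_exp 1) h * bgf ^ M) M"
    by (simp only: fps_X_mult_nth) simp
  moreover have "eval_at (chi q (int j)) ([:- 1, 1:] * h) / (chi q (int j) - 1) ^ Suc M
      = eval_at (chi q (int j)) h / (chi q (int j) - 1) ^ M" if "j \<in> {1..<q}" for j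
    unfolding eval_at_mult using chi_neq_1[OF that] by simp
  ultimately show ?thesis
    unfolding root_residue_sum_def by (simp only: cong: sum.cong)
qed

text \<open>The sum of a fixed power over all \<open>q\<close>-th roots of unity is \<open>q\<close>
  or 0.\<close>

lemma sum_eval_at_roots:
  assumes "q > 0"
  shows "\<exists>i. (\<Sum>j<q. eval_at (chi q (int j)) h) = of_int (int q * i)"
proof -
  have "(\<Sum>j<q. eval_at (chi q (int j)) h)
      = (\<Sum>i\<le>degree h. of_int (coeff h i) * (\<Sum>j<q. chi q (int j * int i)))"
    unfolding eval_at_altdef sum_distrib_left chi_power by (rule sum.swap)
  also have "\<dots> = (\<Sum>i\<le>degree h. of_int (int q * (if int q dvd int i then coeff h i else 0)))"
    unfolding sum_chi[OF assms] by (intro sum.cong refl) simp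
  also have "\<dots> = of_int (int q * (\<Sum>i\<le>degree h. if int q dvd int i then coeff h i else 0))"
    by (simp only: sum_distrib_left of_int_sum)
  finally show ?thesis ..
qed

lemma sum_lessThan_eq_head: "q > 0 \<Longrightarrow> (\<Sum>j<q. f j) = f 0 + (\<Sum>j=1..<q. f j)"
  for f :: "nat \<Rightarrow> 'a::comm_monoid_add"
  by (simp add: sum.atLeast_Suc_lessThan flip: atLeast0LessThan)

text \<open>Without a pole the constant term is \<open>h(1)\<close>, the missing summand at the root
  1.\<close>

lemma root_residue_sum_0:
  assumes "q > 0"
  shows "\<exists>i. root_residue_sum q 0 h = of_int (int q * i)"
proof -
  have "eval_at 1 h = (of_int (poly h 1) :: complex)"
    by (induction h) simp_all
  then have "root_residue_sum q 0 h = (\<Sum>j<q. eval_at (chi q (int j)) h)"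
    unfolding root_residue_sum_def sum_lessThan_eq_head[OF assms]
    by (simp add: eval_at_exp_nth_0)
  then show ?thesis
    using sum_eval_at_roots[OF assms] by simp
qed

text \<open>The fractions are \<open>M!\<close> times values of \<open>bernoulli_fourier\<close>,
  and the constant term supplies the value at 1. Summing over all characters inverts the transform
  and keeps only \<open>k = 0\<close>.\<close>

lemma root_residue_sum_hpoly:
  assumes "q > 0"
  shows "root_residue_sum q (Suc M) (hpoly M 1 [:- 1, 1:])
    = of_real (fact M * real q ^ Suc M * fps_nth bgf (Suc M))"
proof -
  have "hpoly M 1 (fps_exp 1 - 1) * bgf ^ Suc M = hpoly M bgf fps_X"
    using hpoly_homogeneous[of M bgf 1 "fps_exp 1 - 1"] by (simp add: bgf_mult_exp mult.commute)
  then have 1: "fps_nth (eval_at (fps_exp 1) (hpoly M 1 [:- 1, 1:]) * bgf ^ Suc M) (Suc M)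
      = fact M * fps_nth bgf (Suc M)"
    by (simp add: eval_at_hpoly hpoly_bgf gbinomial_of_nat_symmetric flip: binomial_gbinomial
        del: power_Suc)
  have 2: "eval_at x (hpoly M 1 [:- 1, 1:]) / (x - 1) ^ Suc M = fact M * bernoulli_fourier q M x"
    if "x = chi q (int j)" "j \<in> {1..<q}" for j x
  proof -
    have x: "x \<noteq> 1" "x ^ q = 1"
      using that chi_neq_1 chi_power_q[OF assms] by auto
    then have "hpoly M (1 / (x - 1)) 1 = (1 / (x - 1)) ^ Suc M * hpoly M 1 (x - 1)"
      using hpoly_homogeneous[of M "1 / (x - 1)" 1 "x - 1"] by simp
    then show ?thesis
      using x assms by (simp add: bernoulli_fourier_hpoly eval_at_hpoly power_one_over divide_simps
          del: power_Suc)
  qed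
  have "root_residue_sum q (Suc M) (hpoly M 1 [:- 1, 1:])
      = fact M * ((\<Sum>j=1..<q. bernoulli_fourier q M (chi q (int j)))
          + of_real (fps_nth bgf (Suc M)))"
  proof -
    have "(\<Sum>j=1..<q. eval_at (chi q (int j)) (hpoly M 1 [:- 1, 1:]) / (chi q (int j) - 1) ^ Suc M)
        = (\<Sum>j=1..<q. fact M * bernoulli_fourier q M (chi q (int j)))"
      by (intro sum.cong refl 2) simp
    then show ?thesis
      unfolding root_residue_sum_def 1 by (simp add: distrib_left sum_distrib_left)
  qed
  also have "\<dots> = fact M * (\<Sum>j<q. bernoulli_fourier q M (chi q (int j)))"
    unfolding sum_lessThan_eq_head[OF assms] by (simp add: bernoulli_fourier_1[OF assms] add.commute)
  also have "(\<Sum>j<q. bernoulli_fourier q M (chi q (int j)))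
      = (\<Sum>k<q. of_real (real q ^ M * fps_nth (bernoulli_gf (real k / real q)) (Suc M))
          * (\<Sum>j<q. chi q (int j * int k)))"
    unfolding bernoulli_fourier_def sum_distrib_left chi_power by (rule sum.swap)
  also have "\<dots> = (\<Sum>k<q. if k = 0 then of_real (real q ^ Suc M * fps_nth bgf (Suc M)) else 0)"
    unfolding sum_chi[OF assms]
    by (intro sum.cong refl) (auto simp: mult_ac dest: nat_dvd_not_less)
  finally show ?thesis
    using assms by (simp add: sum.delta)
qed

text \<open>
  \<open>hpoly M 1 (x - 1)\<close> takes the value \<open>\<plusminus> M!\<close> at \<open>x = 1\<close>, so subtracting a multiple of it from \<open>M! h\<close> leaves a
  polynomial divisible by \<open>x - 1\<close>, to which the induction hypothesis applies.
\<close>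

lemma root_residue_sum_dvd:
  "\<exists>D::nat. D > 0 \<and> (\<forall>q h. q > 0 \<longrightarrow> (\<exists>i. of_nat D * root_residue_sum q M h = of_int (int q * i)))"
proof (induction M)
  case 0
  then show ?case
    using root_residue_sum_0 by (intro exI[of _ 1]) simp
next
  case (Suc M)
  then obtain D where D: "D > 0"
    "\<And>q h. q > 0 \<Longrightarrow> \<exists>i. of_nat D * root_residue_sum q M h = of_int (int q * i)"
    by blast
  obtain b where b: "of_int (denom_bound (Suc M)) * fps_nth bgf (Suc M) = of_int (1 * b)"
    using int_fps_bgf by (rule int_fpsD)
  let ?w = "nat (denom_bound (Suc M))"
  have w: "of_int (denom_bound (Suc M)) = (of_nat ?w :: complex)" "of_int (denom_bound (Suc M)) = real ?w"
    using denom_bound_pos[of "Suc M"] by simp_all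
  \<comment> \<open>\<open>fact M\<close> permits the subtraction that creates a zero at 1,
    \<open>D\<close> serves the quotient by \<open>x - 1\<close>, and \<open>?w\<close> clears the
    Bernoulli denominator.\<close>
  have "\<exists>i. of_nat (fact M * D * ?w) * root_residue_sum q (Suc M) h = of_int (int q * i)"
    if q: "q > 0" for q h
  proof -
    let ?c = "(- 1) ^ M * poly h 1"
    let ?h = "smult (fact M) h - smult ?c (hpoly M 1 [:- 1, 1:])"
    have "eval_at 1 (hpoly M 1 [:- 1, 1:]) = (- 1) ^ M * (fact M :: int)"
      unfolding eval_at_hpoly by (simp add: hpoly_at_0)
    then have "poly (hpoly M 1 [:- 1, 1:]) 1 = (- 1) ^ M * (fact M :: int)"
      by (simp add: eval_at_def)
    then have "poly ?h 1 = fact M * poly h 1 - ((- 1) ^ M * (- 1) ^ M) * (fact M * poly h 1)"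
      by (simp add: mult_ac)
    also have "(- 1) ^ M * (- 1) ^ M = (1 :: int)"
      by (simp flip: power_mult_distrib)
    finally have "poly ?h 1 = 0"
      by simp
    then obtain g where g: "?h = [:- 1, 1:] * g"
      unfolding poly_eq_0_iff_dvd by (elim dvdE)
    have "fact M * root_residue_sum q (Suc M) h
        = root_residue_sum q (Suc M) (smult (fact M) h)"
      by (simp add: root_residue_sum_smult)
    also have "smult (fact M) h = smult ?c (hpoly M 1 [:- 1, 1:]) + [:- 1, 1:] * g"
      unfolding g[symmetric] by simp
    also have "root_residue_sum q (Suc M) (smult ?c (hpoly M 1 [:- 1, 1:]) + [:- 1, 1:] * g)
        = of_int ?c * of_real (fact M * real q ^ Suc M * fps_nth bgf (Suc M))
          + root_residue_sum q M g"
      unfolding root_residue_sum_add root_residue_sum_smult root_residue_sum_Suc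
        root_residue_sum_hpoly[OF q] ..
    finally have e: "fact M * root_residue_sum q (Suc M) h = \<dots>" .
    obtain i where i: "of_nat D * root_residue_sum q M g = of_int (int q * i)"
      using D(2)[OF q] by blast
    have wb: "of_nat ?w * of_real (fps_nth bgf (Suc M)) = (of_int b :: complex)"
      using arg_cong[OF b, of of_real] unfolding w by simp
    have "of_nat (fact M * D * ?w) * root_residue_sum q (Suc M) h
        = of_nat D * of_nat ?w * (fact M * root_residue_sum q (Suc M) h)"
      by simp
    also have "\<dots> = of_nat D * of_int ?c * fact M * of_nat q ^ Suc M
          * (of_nat ?w * of_real (fps_nth bgf (Suc M)))
        + of_nat ?w * (of_nat D * root_residue_sum q M g)"
      unfolding e by (simp add: algebra_simps)
    also have "\<dots> = of_int (int q * (int D * ?c * fact M * int q ^ M * b + int ?w * i))"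
      unfolding wb i by (simp add: algebra_simps)
    finally show ?thesis ..
  qed
  moreover have "fact M * D * ?w > 0"
    using D(1) denom_bound_pos[of "Suc M"] by simp
  ultimately show ?case
    by blast
qed

section \<open>The Dedekind sum as a sum over roots of unity\<close>

text \<open>Orthogonality of characters detects the value \<open>l\<close> of the linear form, after
  which the sum over \<open>k\<close> factors. The character of \<open>- l\<close> is the source of
  the convention that the last \<open>p\<close> is -1.\<close>

lemma fourier_sum_PiE:
  fixes f :: "'a \<Rightarrow> int \<Rightarrow> complex" and g :: "int \<Rightarrow> complex"
  assumes q: "q > 0" and I: "finite I" and per: "\<And>x. g (x mod int q) = g x"
  shows "of_nat q * (\<Sum>k\<in>I \<rightarrow>\<^sub>E {0..<int q}. (\<Prod>i\<in>I. f i (k i)) * g (\<Sum>i\<in>I. p i * k i))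
    = (\<Sum>j<q. (\<Prod>i\<in>I. \<Sum>k\<in>{0..<int q}. f i k * chi q (int j * p i * k))
        * (\<Sum>l\<in>{0..<int q}. g l * chi q (int j * (- 1) * l)))"
proof -
  let ?P = "I \<rightarrow>\<^sub>E {0..<int q}" and ?Q = "{0..<int q}"
  let ?s = "\<lambda>k. \<Sum>i\<in>I. p i * k i" and ?F = "\<lambda>k. \<Prod>i\<in>I. f i (k i)"
  have orth: "(\<Sum>l\<in>?Q. g l * (\<Sum>j<q. chi q (int j * (x - l)))) = of_nat q * g x" for x
  proof -
    have "int q dvd x - l \<longleftrightarrow> l = x mod int q" if "l \<in> ?Q" for l
      using that q by (metis atLeastLessThan_iff mod_eq_dvd_iff mod_pos_pos_trivial)
    then have "(\<Sum>l\<in>?Q. g l * (\<Sum>j<q. chi q (int j * (x - l))))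
        = (\<Sum>l\<in>?Q. if l = x mod int q then of_nat q * g l else 0)"
      unfolding sum_chi[OF q] by (intro sum.cong refl) (simp add: mult.commute)
    also have "\<dots> = of_nat q * g (x mod int q)"
      using q by (subst sum.delta) auto
    finally show ?thesis
      by (simp only: per)
  qed
  have "(\<Sum>j<q. (\<Prod>i\<in>I. \<Sum>k\<in>?Q. f i k * chi q (int j * p i * k))
        * (\<Sum>l\<in>?Q. g l * chi q (int j * (- 1) * l)))
      = (\<Sum>j<q. \<Sum>k\<in>?P. \<Sum>l\<in>?Q. ?F k * (g l * chi q (int j * (?s k - l))))"
  proof (intro sum.cong refl)
    fix j
    have "(\<Prod>i\<in>I. \<Sum>k\<in>?Q. f i k * chi q (int j * p i * k))
        = (\<Sum>k\<in>?P. \<Prod>i\<in>I. f i (k i) * chi q (int j * p i * k i))"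
      using I by (intro prod_sum_PiE) auto
    also have "\<dots> = (\<Sum>k\<in>?P. ?F k * chi q (int j * ?s k))"
      by (simp add: prod.distrib chi_sum sum_distrib_left mult.assoc)
    finally have F: "(\<Prod>i\<in>I. \<Sum>k\<in>?Q. f i k * chi q (int j * p i * k)) = \<dots>" .
    have "chi q (int j * (?s k - l)) = chi q (int j * ?s k) * chi q (int j * (- 1) * l)" for k l
      unfolding chi_add[symmetric] by (simp add: algebra_simps)
    then show "(\<Prod>i\<in>I. \<Sum>k\<in>?Q. f i k * chi q (int j * p i * k))
        * (\<Sum>l\<in>?Q. g l * chi q (int j * (- 1) * l))
      = (\<Sum>k\<in>?P. \<Sum>l\<in>?Q. ?F k * (g l * chi q (int j * (?s k - l))))"
      unfolding F sum_product by (intro sum.cong refl) (simp only: mult_ac)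
  qed
  also have "\<dots> = (\<Sum>k\<in>?P. \<Sum>j<q. \<Sum>l\<in>?Q. ?F k * (g l * chi q (int j * (?s k - l))))"
    by (rule sum.swap)
  also have "\<dots> = (\<Sum>k\<in>?P. \<Sum>l\<in>?Q. \<Sum>j<q. ?F k * (g l * chi q (int j * (?s k - l))))"
    by (intro sum.cong refl sum.swap)
  also have "\<dots> = (\<Sum>k\<in>?P. ?F k * (of_nat q * g (?s k)))"
    unfolding sum_distrib_left[symmetric] orth ..
  finally show ?thesis
    by (simp add: sum_distrib_left mult_ac)
qed

lemma periodic_bernoulli_mod:
  assumes "q > 0"
  shows "periodic_bernoulli r (of_int (x mod int q) / of_int (int q))
    = periodic_bernoulli r (of_int x / of_int (int q))"
proof -
  let ?y = "of_int (x mod int q) / of_int (int q) :: real"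
  have "of_int x = of_int (x div int q) * of_int (int q) + (of_int (x mod int q) :: real)"
    by (metis div_mult_mod_eq of_int_add of_int_mult)
  then have e: "of_int x / of_int (int q) = of_int (x div int q) + ?y"
    using assms by (simp add: field_simps)
  have "of_int (x div int q) + ?y \<in> \<int> \<longleftrightarrow> ?y \<in> \<int>"
    by (metis Ints_add Ints_diff Ints_of_int add_diff_cancel_left')
  moreover have "frac (of_int (x div int q) + ?y) = frac ?y"
    by (simp add: frac_def)
  ultimately show ?thesis
    unfolding periodic_bernoulli_def e by simp
qed

text \<open>The factors \<open>q ^ (r - 1) / fact r\<close> distribute \<open>q^(N - n)\<close> and
  the factorials over the transforms; the one remaining \<open>q\<close> is spent on Fourier
  inversion.\<close>

definition bernoulli_hat :: "nat \<Rightarrow> nat \<Rightarrow> int \<Rightarrow> complex" where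
  "bernoulli_hat q r t
    = (\<Sum>k\<in>{0..<int q}. of_real (real q ^ (r - 1) * periodic_bernoulli r (of_int k / of_int (int q)) / fact r)
        * chi q (t * k))"

text \<open>The periodic function differs from the polynomial only for \<open>r = 1\<close> at
  \<open>k = 0\<close>, where -1/2 becomes 0.\<close>

lemma bernoulli_hat_eq:
  assumes q: "q > 0" and r: "r > 0"
  shows "bernoulli_hat q r t
    = bernoulli_fourier q (r - 1) (chi q t) + (if r = 1 then 1 / 2 else 0)"
proof -
  let ?b = "\<lambda>k. real q ^ (r - 1) * fps_nth (bernoulli_gf (real k / real q)) r"
  let ?d = "if r = 1 then 1 / 2 else 0 :: real"
  have pb: "real q ^ (r - 1) * periodic_bernoulli r (of_int (int k) / of_int (int q)) / fact r
      = ?b k + (if k = 0 then ?d else 0)" if "k < q" for k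
  proof (cases "k = 0")
    case True
    then show ?thesis
      by (auto simp: periodic_bernoulli_def bernoulli_number_def bernoulli_poly_def)
  next
    case False
    then have k: "real k / real q > 0" "real k / real q < 1"
      using that by simp_all
    then have f: "frac (real k / real q) = real k / real q"
      by (simp add: frac_eq)
    then have "real k / real q \<notin> \<int>"
      using k(1) by (metis frac_eq_0_iff less_irrefl)
    with False f show ?thesis
      by (simp add: periodic_bernoulli_def bernoulli_poly_def)
  qed
  have "bernoulli_hat q r t
      = (\<Sum>k<q. of_real (real q ^ (r - 1) * periodic_bernoulli r (of_int (int k) / of_int (int q)) / fact r)
          * chi q (t * int k))"
    unfolding bernoulli_hat_def
    by (rule sum.reindex_bij_witness[of _ int nat]) auto
  also have "\<dots> = (\<Sum>k<q. of_real (?b k) * chi q t ^ k + (if k = 0 then of_real ?d else 0))"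
  proof (intro sum.cong refl)
    fix k assume "k \<in> {..<q}"
    then show "of_real (real q ^ (r - 1) * periodic_bernoulli r (of_int (int k) / of_int (int q)) / fact r)
          * chi q (t * int k)
        = of_real (?b k) * chi q t ^ k + (if k = 0 then of_real ?d else 0)"
      unfolding pb[OF \<open>k \<in> {..<q}\<close>[unfolded lessThan_iff]] chi_power
      by (cases "k = 0") (simp_all add: distrib_right)
  qed
  also have "\<dots> = bernoulli_fourier q (r - 1) (chi q t) + of_real ?d"
    using q r by (simp add: sum.distrib bernoulli_fourier_def sum.delta)
  finally show ?thesis
    by simp
qed

lemma bernoulli_hat_trivial:
  assumes "q > 0" "r > 0" "int q dvd t"
  shows "bernoulli_hat q r t = of_real (bcoeff r)"
  using assms chi_eq_1_iff[of q t]
  by (auto simp: bernoulli_hat_eq bernoulli_fourier_1 bcoeff_def)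

lemma bernoulli_hat_nontrivial:
  assumes "q > 0" "r > 0" "\<not> int q dvd t"
  shows "2 * fact (r - 1) * bernoulli_hat q r t = hpoly_half r (1 / (chi q t - 1)) 1"
proof -
  have "fact (r - 1) * bernoulli_fourier q (r - 1) (chi q t) = hpoly (r - 1) (1 / (chi q t - 1)) 1"
    using assms chi_eq_1_iff[of q t] by (intro bernoulli_fourier_hpoly) (auto simp: chi_power_q)
  then show ?thesis
    using assms by (auto simp: bernoulli_hat_eq hpoly_half_def distrib_left mult.assoc)
qed

lemma dedekind_sum_fourier:
  assumes n: "n \<ge> 1" and q: "q > 0" and r: "\<forall>i\<in>{1..n}. r i > 0"
  shows "of_real (real q ^ ((\<Sum>i=1..n. r i) - n + 1) / (\<Prod>i=1..n. fact (r i))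
      * dedekind_sum n r (int q) p)
    = (\<Sum>j<q. \<Prod>i=1..n. bernoulli_hat q (r i) (int j * (p(n := - 1)) i))"
proof -
  obtain m where m: "n = Suc m"
    using n by (cases n) auto
  define f :: "nat \<Rightarrow> int \<Rightarrow> complex" where "f i k
    = of_real (real q ^ (r i - 1) * periodic_bernoulli (r i) (of_int k / of_int (int q)) / fact (r i))"
    for i k
  \<comment> \<open>The inequality joins the induction because subtraction of natural numbers
    truncates.\<close>
  have "(\<Sum>i\<in>A. r i) - card A = (\<Sum>i\<in>A. r i - 1) \<and> card A \<le> (\<Sum>i\<in>A. r i)"
    if "finite A" "A \<subseteq> {1..n}" for A
    using that
  proof (induction A rule: finite_induct)
    case (insert x A)
    then have "r x > 0"
      using r by auto
    with insert show ?case
      by auto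
  qed simp
  from this[of "{1..n}"] have "(\<Sum>i=1..n. r i) - n = (\<Sum>i=1..n. r i - 1)"
    by simp
  then have pow: "real q ^ ((\<Sum>i=1..n. r i) - n + 1) = real q * (\<Prod>i=1..n. real q ^ (r i - 1))"
    by (simp add: power_sum)
  define c where "c i = real q ^ (r i - 1) / fact (r i)" for i
  have f_eq: "f i k = of_real (c i * periodic_bernoulli (r i) (of_int k / of_int (int q)))" for i k
    by (simp add: f_def c_def)
  have coeff: "real q ^ ((\<Sum>i=1..n. r i) - n + 1) / (\<Prod>i=1..n. fact (r i))
      = real q * ((\<Prod>i=1..m. c i) * c n)"
    unfolding pow c_def prod_dividef by (simp add: m)
  have "of_real (real q ^ ((\<Sum>i=1..n. r i) - n + 1) / (\<Prod>i=1..n. fact (r i))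
        * dedekind_sum n r (int q) p)
      = of_nat q * (\<Sum>k \<in> {1..m} \<rightarrow>\<^sub>E {0..<int q}. (\<Prod>i=1..m. f i (k i))
          * f n (\<Sum>i=1..m. p i * k i))"
  proof -
    have "n - 1 = m"
      using m by simp
    then show ?thesis
      unfolding dedekind_sum_def coeff f_eq of_real_prod[symmetric] prod.distrib
      by (simp add: sum_distrib_left mult_ac)
  qed
  also have "\<dots> = (\<Sum>j<q. (\<Prod>i\<in>{1..m}. \<Sum>k\<in>{0..<int q}. f i k * chi q (int j * p i * k))
        * (\<Sum>l\<in>{0..<int q}. f n l * chi q (int j * (- 1) * l)))"
    by (rule fourier_sum_PiE) (simp_all only: q f_def periodic_bernoulli_mod finite_atLeastAtMost)
  also have "\<dots> = (\<Sum>j<q. \<Prod>i=1..n. bernoulli_hat q (r i) (int j * (p(n := - 1)) i))"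
    by (simp add: m bernoulli_hat_def f_def)
  finally show ?thesis .
qed

section \<open>Reduction modulo q\<close>

definition tuples :: "nat \<Rightarrow> nat \<Rightarrow> (nat \<Rightarrow> nat) set" where
  "tuples n N = {m \<in> {1..n} \<rightarrow>\<^sub>E UNIV. (\<Sum>i=1..n. m i) = N}"

lemma finite_tuples: "finite (tuples n N)"
proof (rule finite_subset)
  show "tuples n N \<subseteq> {1..n} \<rightarrow>\<^sub>E {..N}"
  proof
    fix m assume "m \<in> tuples n N"
    moreover from this have "m i \<le> N" if "i \<in> {1..n}" for i
      using that member_le_sum[of i "{1..n}" m] by (auto simp: tuples_def)
    ultimately show "m \<in> {1..n} \<rightarrow>\<^sub>E {..N}"
      by (simp add: tuples_def PiE_iff)
  qed
qed (auto intro: finite_PiE)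

text \<open>A multiset of size \<open>N\<close> over \<open>{1..n}\<close> corresponds to the tuple
  of its multiplicities.\<close>

lemma fps_prod_nth_tuples:
  "fps_nth (\<Prod>i=1..n. f i) N = (\<Sum>m\<in>tuples n N. \<Prod>i=1..n. fps_nth (f i) (m i))"
  unfolding fps_prod_nth'[OF finite_atLeastAtMost]
proof (rule sum.reindex_bij_witness[of _ "\<lambda>m. \<Sum>i=1..n. replicate_mset (m i) i"
      "\<lambda>X. restrict (count X) {1..n}"])
  fix X assume X: "X \<in> multisets_of_size {1..n} N"
  then have sub: "set_mset X \<subseteq> {1..n}" and size: "size X = N"
    by (auto simp: multisets_of_size_def)
  show "(\<Sum>i=1..n. replicate_mset (restrict (count X) {1..n} i) i) = X"
  proof (rule multiset_eqI)
    fix y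
    show "count (\<Sum>i=1..n. replicate_mset (restrict (count X) {1..n} i) i) y = count X y"
      using sub by (auto simp: count_sum not_in_iff[symmetric])
  qed
  have "size X = (\<Sum>i=1..n. count X i)"
    unfolding size_multiset_overloaded_eq using sub
    by (intro sum.mono_neutral_left) (auto simp: not_in_iff)
  then show "restrict (count X) {1..n} \<in> tuples n N"
    using size by (simp add: tuples_def)
  show "(\<Prod>i=1..n. fps_nth (f i) (restrict (count X) {1..n} i))
      = (\<Prod>i=1..n. fps_nth (f i) (count X i))"
    by simp
next
  fix m assume m: "m \<in> tuples n N"
  have c: "count (\<Sum>i=1..n. replicate_mset (m i) i) y = (if y \<in> {1..n} then m y else 0)" for y
    by (simp add: count_sum)
  show "restrict (count (\<Sum>i=1..n. replicate_mset (m i) i)) {1..n} = m"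
    using m unfolding c by (auto simp: tuples_def PiE_iff extensional_def)
  have "size (\<Sum>i=1..n. replicate_mset (m i) i) = N"
    using m by (simp add: tuples_def)
  moreover have "set_mset (\<Sum>i=1..n. replicate_mset (m i) i) \<subseteq> {1..n}"
  proof
    fix y assume "y \<in># (\<Sum>i=1..n. replicate_mset (m i) i)"
    then show "y \<in> {1..n}"
      unfolding count_greater_zero_iff[symmetric] c by (simp split: if_splits)
  qed
  ultimately show "(\<Sum>i=1..n. replicate_mset (m i) i) \<in> multisets_of_size {1..n} N"
    by (simp add: multisets_of_size_def)
qed

text \<open>This is \<open>(x^(a b) - 1) / (x^a - 1)\<close>; for \<open>a b \<equiv> 1\<close>
  modulo \<open>q\<close> its value at a \<open>q\<close>-th root of unity
  \<open>x \<noteq> 1\<close> is \<open>(x - 1) / (x^a - 1)\<close>.\<close>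

definition inverse_quotient :: "nat \<Rightarrow> nat \<Rightarrow> int poly" where
  "inverse_quotient a b = (\<Sum>l<b. [:0, 1:] ^ (a * l))"

lemma eval_at_inverse_quotient:
  "eval_at x (inverse_quotient a b) * (x ^ a - 1) = x ^ (a * b) - 1"
proof -
  have "eval_at x (inverse_quotient a b) = (\<Sum>l<b. (x ^ a) ^ l)"
    by (simp add: inverse_quotient_def eval_at_sum eval_at_power power_mult)
  then show ?thesis
    using power_diff_1_eq[of "x ^ a" b] by (simp add: power_mult mult.commute)
qed

lemma int_fps_eval_at: "int_fps 1 f \<Longrightarrow> int_fps 1 (eval_at f h)"
  by (induction h) (auto intro!: int_fps_add int_fps_mult)

text \<open>With \<open>a b = 1 + l q\<close>, the series \<open>exp (a b X) - 1\<close> is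
  congruent to \<open>exp X - 1\<close> modulo \<open>q\<close>. Hence \<open>a z\<close> is
  congruent to \<open>a X / (exp (a X) - 1)\<close>, which is \<open>w\<close>.\<close>

lemma inverse_quotient_series:
  assumes a: "a > 0" and ab: "a * b = 1 + l * q"
  defines "z \<equiv> eval_at (fps_exp 1) (inverse_quotient a b) * bgf"
    and "w \<equiv> bgf oo (fps_const (of_nat a) * fps_X)"
  shows "int_fps 1 z" "int_fps 1 w" "int_fps (int q) (of_nat a * z - w)"
proof -
  have "int_fps 1 (eval_at (fps_exp (of_int 1)) (inverse_quotient a b))"
    by (intro int_fps_eval_at int_fps_exp)
  then show z: "int_fps 1 z"
    unfolding z_def by (intro int_fps_mult int_fps_bgf) simp
  \<comment> \<open>\<open>u\<close> is \<open>(exp (a X) - 1) / (a X)\<close>, the inverse of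
    \<open>w\<close>; \<open>v\<close> below is \<open>(exp (l q X) - 1) / X\<close>, a multiple of
    \<open>q\<close>.\<close>
  define u where "u = Abs_fps (\<lambda>m. of_int (int a ^ m) / fact (Suc m) :: real)"
  have "u = Abs_fps (\<lambda>m. of_int 1 / fact (Suc m)) oo (fps_const (of_nat a) * fps_X)"
    by (simp add: u_def fps_eq_iff)
  then have wu: "w * u = 1"
    using arg_cong[OF bgf_mult_unit, of "\<lambda>f. f oo (fps_const (of_nat a) * fps_X)"]
    by (simp add: w_def fps_compose_mult_distrib)
  show w: "int_fps 1 w"
    by (rule int_fps_inverse[OF _ _ wu]) (unfold u_def, rule int_fps_exp_shift, simp_all)
  define v where "v = Abs_fps (\<lambda>m. of_int (int (l * q) ^ Suc m) / fact (Suc m) :: real)"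
  have v: "int_fps (int q) v"
    unfolding v_def by (rule int_fps_exp_shift) simp
  have u_exp: "fps_X * (of_nat a * u) = fps_exp (of_nat a) - 1"
    by (rule fps_ext, rename_tac k, case_tac k)
      (simp_all add: u_def fps_of_nat[symmetric] del: fact_Suc)
  have v_exp: "fps_X * v = fps_exp (of_nat (l * q)) - 1"
    by (rule fps_ext, rename_tac k, case_tac k) (simp_all add: v_def del: fact_Suc)
  have "fps_X * (of_nat a * z * u) = bgf * (eval_at (fps_exp 1) (inverse_quotient a b)
      * (fps_exp 1 ^ a - 1))"
    unfolding z_def fps_exp_power_mult using u_exp by (simp add: mult_ac)
  also have "\<dots> = bgf * (fps_exp 1 ^ (a * b) - 1)"
    unfolding eval_at_inverse_quotient ..
  also have "fps_exp 1 ^ (a * b) - 1 = fps_exp 1 - 1 + fps_exp 1 * (fps_X * v)"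
    unfolding v_exp ab fps_exp_power_mult by (simp add: algebra_simps flip: fps_exp_add_mult)
  also have "bgf * \<dots> = fps_X * (1 + v * (bgf * fps_exp 1))"
    unfolding distrib_left bgf_mult_exp by (simp add: mult_ac)
  finally have azu: "of_nat a * z * u = 1 + v * (bgf * fps_exp 1)"
    by (subst (asm) mult_cancel_left) simp
  have "of_nat a * z = (of_nat a * z * u) * w"
    using wu by (simp add: mult_ac)
  also have "\<dots> = w + v * (bgf * fps_exp 1 * w)"
    unfolding azu by (simp add: algebra_simps)
  finally have "of_nat a * z - w = v * (bgf * fps_exp (of_int 1) * w)"
    by simp
  then show "int_fps (int q) (of_nat a * z - w)"
    by (simp only:) (intro int_fps_mult v w int_fps_bgf int_fps_exp)
qed

text \<open>
  Multiplying by \<open>a\<^sup>r\<close> and using homogeneity avoids dividing by \<open>a\<close>; the power \<open>b\<^sup>r\<close> then undoes the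
  multiplication modulo \<open>q\<close>.
\<close>

lemma hpoly_half_inverse_quotient:
  assumes a: "a > 0" and r: "r > 0" and ab: "a * b = 1 + l * q"
  shows "int_fps (int q) (hpoly_half r (eval_at (fps_exp 1) (inverse_quotient a b) * bgf) fps_X
    - of_nat b ^ r * (hpoly_half r bgf fps_X oo (fps_const (of_nat a) * fps_X)))"
proof -
  define z where "z = eval_at (fps_exp 1) (inverse_quotient a b) * bgf"
  define w where "w = bgf oo (fps_const (of_nat a) * fps_X)"
  note zw = inverse_quotient_series[OF a ab, folded z_def w_def]
  let ?x = "of_nat a * fps_X :: real fps"
  have x: "?x = fps_const (of_nat a) * fps_X"
    by (simp add: fps_of_nat)
  have Z: "int_fps 1 (hpoly_half r z fps_X)"
    by (intro int_fps_hpoly_half zw) simp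
  have "int_fps (int q) (hpoly_half r (of_nat a * z) ?x - hpoly_half r w ?x)"
    by (intro int_fps_hpoly_half_diff int_fps_mult zw int_fps_of_nat int_fps_X)
  then have "int_fps (int q) (of_nat a ^ r * hpoly_half r z fps_X - hpoly_half r w ?x)"
    unfolding hpoly_half_homogeneous[OF r] .
  then have 1: "int_fps (int q) ((of_nat a ^ r * hpoly_half r z fps_X - hpoly_half r w ?x) * of_nat b ^ r)"
    by (intro int_fps_mult int_fps_power int_fps_of_nat)
  have "[(a * b) ^ r = 1 ^ r] (mod q)"
    by (intro cong_pow) (simp only: ab cong_def mod_mult_self1)
  then have "[int ((a * b) ^ r) = int 1] (mod int q)"
    unfolding cong_int_iff by simp
  then obtain k where "int ((a * b) ^ r) = 1 + int q * k"
    by (metis cong_iff_lin cong_sym of_nat_1)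
  then have "(of_int (int ((a * b) ^ r)) :: real fps) = 1 + of_int (int q * k)"
    by simp
  then have k: "(of_nat a ^ r * of_nat b ^ r :: real fps) = 1 + fps_const (of_int (int q * k))"
    unfolding fps_of_int by (simp add: power_mult_distrib)
  have "int_fps (int q) (fps_const (of_int (int q * k)) * hpoly_half r z fps_X)"
    by (intro int_fps_const_mult Z)
  from int_fps_diff[OF 1 this]
  have "int_fps (int q) (of_nat a ^ r * of_nat b ^ r * hpoly_half r z fps_X
      - fps_const (of_int (int q * k)) * hpoly_half r z fps_X - of_nat b ^ r * hpoly_half r w ?x)"
    by (simp add: algebra_simps)
  then have "int_fps (int q) (hpoly_half r z fps_X - of_nat b ^ r * hpoly_half r w ?x)"
    unfolding k by (simp add: distrib_right)
  then show ?thesis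
    unfolding z_def w_def x hpoly_half_compose_bgf .
qed

text \<open>Pairs \<open>a * b\<close> cancel. If powers of \<open>b\<close> remain, uniqueness of
  inverses identifies \<open>b\<close> with \<open>modular_inverse q p\<close>.\<close>

lemma mod_power_int_cong:
  fixes q :: int
  assumes a: "[a = p] (mod q)" and ab: "[a * b = 1] (mod q)"
  shows "[b ^ r * a ^ m = mod_power_int q p (int m - int r)] (mod q)"
proof (cases "r \<le> m")
  case True
  then have "b ^ r * a ^ m = (a * b) ^ r * a ^ (m - r)"
    by (simp add: power_mult_distrib mult_ac flip: power_add)
  also have "[\<dots> = 1 ^ r * p ^ (m - r)] (mod q)"
    by (intro cong_mult cong_pow a ab)
  finally show ?thesis
    using True by (simp add: mod_power_int_def nat_diff_distrib)
next
  case False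
  have pb: "[p * b = 1] (mod q)"
    using a ab by (metis cong_mult cong_refl cong_sym cong_trans)
  then have "coprime p q"
    by (metis cong_imp_coprime cong_sym coprime_1_left coprime_mult_left_iff)
  then have inv: "[p * modular_inverse q p = 1] (mod q)"
    by (rule cong_modular_inverse1)
  have "[b = b * (p * modular_inverse q p)] (mod q)"
    using cong_mult[OF cong_refl[of b] cong_sym[OF inv]] by simp
  also have "b * (p * modular_inverse q p) = (p * b) * modular_inverse q p"
    by simp
  also have "[\<dots> = 1 * modular_inverse q p] (mod q)"
    by (intro cong_mult pb cong_refl)
  finally have b: "[b = modular_inverse q p] (mod q)"
    by simp
  have "b ^ r * a ^ m = (a * b) ^ m * b ^ (r - m)"
    using False by (simp add: power_mult_distrib mult_ac flip: power_add)
  also have "[\<dots> = 1 ^ m * modular_inverse q p ^ (r - m)] (mod q)"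
    by (intro cong_mult cong_pow b ab)
  finally show ?thesis
    using False by (simp add: mod_power_int_def nat_diff_distrib)
qed

text \<open>Exponents of polynomials must be natural numbers. Adding \<open>q\<close> makes both
  representatives positive, so that \<open>l\<close> is natural as well.\<close>

lemma natural_representatives:
  assumes q: "q > 0" and cop: "coprime p (int q)"
  shows "\<exists>a b l. a > 0 \<and> a * b = 1 + l * q \<and> [int a = p] (mod int q)"
proof -
  define a where "a = nat (p mod int q) + q"
  define b where "b = nat (modular_inverse (int q) p) + q"
  have a: "[int a = p] (mod int q)"
    using q by (simp add: a_def cong_def)
  have "[int b = modular_inverse (int q) p] (mod int q)"
    using q by (simp add: b_def cong_def modular_inverse_int_nonneg)
  then have "[int a * int b = p * modular_inverse (int q) p] (mod int q)"
    by (intro cong_mult a)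
  also have "[p * modular_inverse (int q) p = 1] (mod int q)"
    using cop by (rule cong_modular_inverse1)
  finally have "[int (a * b) = int 1] (mod int q)"
    by simp
  then have "[a * b = 1] (mod q)"
    unfolding cong_int_iff .
  moreover have "a * b \<ge> 1"
    using q by (simp add: a_def b_def)
  ultimately obtain l where "a * b = 1 + l * q"
    by (metis cong_le_nat cong_sym mult.commute add.commute)
  then show ?thesis
    using a q by (intro exI[of _ a] exI[of _ b] exI[of _ l]) (simp add: a_def)
qed

text \<open>The root 1 gives the product of the \<open>bcoeff\<close>; the other roots give the sum
  inside \<open>root_residue_sum\<close>, whose constant term is subtracted again.\<close>

lemma sum_prod_bernoulli_hat:
  fixes r a b l :: "nat \<Rightarrow> nat" and p :: "nat \<Rightarrow> int"
  assumes q: "q > 0" and r: "\<And>i. i \<in> {1..n} \<Longrightarrow> r i > 0" "(\<Sum>i=1..n. r i) = N"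
    and ab: "\<And>i. i \<in> {1..n} \<Longrightarrow> a i * b i = 1 + l i * q"
    and ap: "\<And>i. i \<in> {1..n} \<Longrightarrow> [int (a i) = p i] (mod int q)"
  shows "(\<Prod>i=1..n. 2 * fact (r i - 1)) * (\<Sum>j<q. \<Prod>i=1..n. bernoulli_hat q (r i) (int j * p i))
    = (\<Prod>i=1..n. 2 * fact (r i - 1)) * of_real (\<Prod>i=1..n. bcoeff (r i))
      + root_residue_sum q N (\<Prod>i=1..n. hpoly_half (r i) (inverse_quotient (a i) (b i)) [:- 1, 1:])
      - of_real (fps_nth (\<Prod>i=1..n. hpoly_half (r i)
          (eval_at (fps_exp 1) (inverse_quotient (a i) (b i)) * bgf) fps_X) N)"
proof -
  let ?h = "\<lambda>i. inverse_quotient (a i) (b i)"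
  let ?H = "\<Prod>i=1..n. hpoly_half (r i) (?h i) [:- 1, 1:]"
  let ?K = "\<Prod>i=1..n. 2 * fact (r i - 1) :: complex"
  have hat: "2 * fact (r i - 1) * bernoulli_hat q (r i) (int j * p i)
      = (1 / (chi q (int j) - 1)) ^ r i * hpoly_half (r i) (eval_at (chi q (int j)) (?h i)) (chi q (int j) - 1)"
    if j: "j \<in> {1..<q}" and i: "i \<in> {1..n}" for i j
  proof -
    let ?x = "chi q (int j)"
    have "chi q (int j * p i) = chi q (int j * int (a i))"
      by (intro chi_cong[OF q] cong_mult cong_refl cong_sym[OF ap[OF i]])
    then have xa: "chi q (int j * p i) = ?x ^ a i"
      by (simp add: chi_power)
    have "?x ^ (a i * b i) = ?x * (?x ^ q) ^ l i"
      unfolding ab[OF i] power_add power_mult by (simp add: power_mult[symmetric] mult.commute)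
    then have h: "eval_at ?x (?h i) * (?x ^ a i - 1) = ?x - 1"
      unfolding eval_at_inverse_quotient by (simp add: chi_power_q[OF q])
    have x: "?x \<noteq> 1"
      using j by (rule chi_neq_1)
    then have xa1: "?x ^ a i \<noteq> 1"
      using h by auto
    then have "\<not> int q dvd int j * p i"
      using chi_eq_1_iff[OF q, of "int j * p i"] xa by simp
    then have "2 * fact (r i - 1) * bernoulli_hat q (r i) (int j * p i)
        = hpoly_half (r i) (1 / (?x ^ a i - 1)) 1"
      using bernoulli_hat_nontrivial[OF q r(1)[OF i]] xa by simp
    also have "1 / (?x ^ a i - 1) = 1 / (?x - 1) * eval_at ?x (?h i)"
      using h x xa1 by (simp add: field_simps)
    \<comment> \<open>Writing 1 as \<open>1 / (?x - 1) * (?x - 1)\<close> lets homogeneity extract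
      the pole of order \<open>r i\<close>.\<close>
    also have "hpoly_half (r i) (1 / (?x - 1) * eval_at ?x (?h i)) 1
        = hpoly_half (r i) (1 / (?x - 1) * eval_at ?x (?h i)) (1 / (?x - 1) * (?x - 1))"
      using x by simp
    also have "\<dots> = (1 / (?x - 1)) ^ r i * hpoly_half (r i) (eval_at ?x (?h i)) (?x - 1)"
      by (rule hpoly_half_homogeneous) (rule r(1)[OF i])
    finally show ?thesis .
  qed
  have nontriv: "?K * (\<Prod>i=1..n. bernoulli_hat q (r i) (int j * p i))
      = eval_at (chi q (int j)) ?H / (chi q (int j) - 1) ^ N" if j: "j \<in> {1..<q}" for j
  proof -
    have "?K * (\<Prod>i=1..n. bernoulli_hat q (r i) (int j * p i))
        = (\<Prod>i=1..n. (1 / (chi q (int j) - 1)) ^ r i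
            * hpoly_half (r i) (eval_at (chi q (int j)) (?h i)) (chi q (int j) - 1))"
      unfolding prod.distrib[symmetric] by (intro prod.cong refl hat j)
    also have "\<dots> = (1 / (chi q (int j) - 1)) ^ N * eval_at (chi q (int j)) ?H"
      unfolding prod.distrib power_sum[symmetric] r(2) eval_at_prod eval_at_hpoly_half by simp
    finally show ?thesis
      by (simp add: power_one_over)
  qed
  have triv: "(\<Prod>i=1..n. bernoulli_hat q (r i) (int 0 * p i)) = of_real (\<Prod>i=1..n. bcoeff (r i))"
    unfolding of_real_prod by (intro prod.cong refl) (simp add: bernoulli_hat_trivial q r(1))
  \<comment> \<open>The same homogeneity, with \<open>bgf\<close> in the role of
    \<open>1 / (x - 1)\<close>.\<close>
  have "eval_at (fps_exp 1) ?H * bgf ^ N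
      = (\<Prod>i=1..n. bgf ^ r i * hpoly_half (r i) (eval_at (fps_exp 1) (?h i)) (fps_exp 1 - 1))"
    unfolding prod.distrib power_sum[symmetric] r(2) eval_at_prod eval_at_hpoly_half by simp
  also have "\<dots> = (\<Prod>i=1..n. hpoly_half (r i) (eval_at (fps_exp 1) (?h i) * bgf) fps_X)"
  proof (intro prod.cong refl)
    fix i assume i: "i \<in> {1..n}"
    show "bgf ^ r i * hpoly_half (r i) (eval_at (fps_exp 1) (?h i)) (fps_exp 1 - 1)
        = hpoly_half (r i) (eval_at (fps_exp 1) (?h i) * bgf) fps_X"
      unfolding mult.commute[of "eval_at (fps_exp 1) (?h i)" bgf] bgf_mult_exp[symmetric]
      by (rule hpoly_half_homogeneous[symmetric]) (rule r(1)[OF i])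
  qed
  finally have series: "eval_at (fps_exp 1) ?H * bgf ^ N = \<dots>" .
  have "?K * (\<Sum>j<q. \<Prod>i=1..n. bernoulli_hat q (r i) (int j * p i))
      = ?K * of_real (\<Prod>i=1..n. bcoeff (r i))
        + (\<Sum>j=1..<q. eval_at (chi q (int j)) ?H / (chi q (int j) - 1) ^ N)"
    unfolding sum_lessThan_eq_head[OF q] distrib_left triv sum_distrib_left
    by (intro arg_cong2[of _ _ _ _ "(+)"] sum.cong refl nontriv)
  then show ?thesis
    unfolding root_residue_sum_def series by simp
qed

text \<open>Here \<open>m - 1\<close> is a natural number below \<open>r - 1\<close>. The case
  \<open>m = 0\<close> differs, since the upper entry -1 gives a nonzero value.\<close>

lemma binomial_int_eq_0: "0 < m \<Longrightarrow> m < r \<Longrightarrow> binomial_int (int m - 1) (r - 1) = 0"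
proof -
  assume m: "0 < m" "m < r"
  then have "real_of_int (int m - 1) = of_nat (m - 1)"
    by simp
  then have "real_of_int (binomial_int (int m - 1) (r - 1)) = of_nat ((m - 1) choose (r - 1))"
    by (simp only: of_int_binomial_int binomial_gbinomial)
  also have "(m - 1) choose (r - 1) = 0"
    using m by (intro binomial_eq_0) simp
  finally show ?thesis
    by simp
qed

lemma binomial_int_self: "0 < r \<Longrightarrow> binomial_int (int r - 1) (r - 1) = 1"
proof -
  assume r: "0 < r"
  then have "real_of_int (int r - 1) = of_nat (r - 1)"
    by simp
  then have "real_of_int (binomial_int (int r - 1) (r - 1)) = of_nat ((r - 1) choose (r - 1))"
    by (simp only: of_int_binomial_int binomial_gbinomial)
  then show ?thesis
    by simp
qed

text \<open>
  A tuple of positive \<open>m\<^sub>i\<close> contributes only if \<open>m\<^sub>i \<ge> r\<^sub>i\<close> for all \<open>i\<close>, and then \<open>m = r\<close> because both have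
  the same sum.
\<close>

lemma sum_tuples_split:
  fixes c :: "(nat \<Rightarrow> nat) \<Rightarrow> int" and r :: "nat \<Rightarrow> nat"
  assumes r: "\<And>i. i \<in> {1..n} \<Longrightarrow> r i > 0" "(\<Sum>i=1..n. r i) = N"
    and odd: "\<And>m i. m \<in> tuples n N \<Longrightarrow> i \<in> {1..n} \<Longrightarrow> odd (m i) \<Longrightarrow> c m = 0"
  shows "(\<Sum>m\<in>tuples n N. c m * (\<Prod>i=1..n. binomial_int (int (m i) - 1) (r i - 1)
        * mod_power_int q (p i) (int (m i) - int (r i))))
    = (\<Sum>m\<in>even_tuples n N. c m * (\<Prod>i=1..n. binomial_int (int (m i) - 1) (r i - 1)
        * mod_power_int q (p i) (int (m i) - int (r i)))) + c (restrict r {1..n})"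
proof -
  let ?t = "\<lambda>m. \<Prod>i=1..n. binomial_int (int (m i) - 1) (r i - 1)
        * mod_power_int q (p i) (int (m i) - int (r i))"
  let ?r = "restrict r {1..n}"
  have sub: "even_tuples n N \<subseteq> tuples n N"
    by (auto simp: even_tuples_def tuples_def)
  have r_mem: "?r \<in> tuples n N - even_tuples n N"
    using r by (auto simp: even_tuples_def tuples_def)
  have zero: "c m * ?t m = 0" if m: "m \<in> tuples n N - even_tuples n N - {?r}" for m
  proof (cases "\<exists>i\<in>{1..n}. odd (m i)")
    case True
    then show ?thesis
      using m odd by auto
  next
    case False
    then have pos: "m i > 0" if "i \<in> {1..n}" for i
      using m that by (auto simp: even_tuples_def tuples_def)
    have "\<exists>i\<in>{1..n}. m i < r i"
    proof (rule ccontr)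
      assume "\<not> (\<exists>i\<in>{1..n}. m i < r i)"
      then have le: "r i \<le> m i" if "i \<in> {1..n}" for i
        using that by force
      have "m i = r i" if i: "i \<in> {1..n}" for i
      proof (rule ccontr)
        assume "m i \<noteq> r i"
        with le[OF i] have "r i < m i"
          by simp
        then have "(\<Sum>i=1..n. r i) < (\<Sum>i=1..n. m i)"
          using le i by (intro sum_strict_mono_ex1) auto
        then show False
          using m r(2) by (simp add: tuples_def)
      qed
      then have "m = ?r"
        using m by (intro extensionalityI[of _ "{1..n}"]) (auto simp: tuples_def PiE_iff)
      then show False
        using m by simp
    qed
    then obtain i where i: "i \<in> {1..n}" "m i < r i"
      by blast
    then have "binomial_int (int (m i) - 1) (r i - 1) = 0"
      using pos by (intro binomial_int_eq_0) auto
    then have "?t m = 0"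
      using i by (intro prod_zero) auto
    then show ?thesis
      by simp
  qed
  have "?t ?r = 1"
  proof (intro prod.neutral ballI)
    fix i assume "i \<in> {1..n}"
    then show "binomial_int (int (?r i) - 1) (r i - 1) * mod_power_int q (p i) (int (?r i) - int (r i)) = 1"
      using binomial_int_self[OF r(1)] by (simp add: mod_power_int_def)
  qed
  then have "(\<Sum>m\<in>tuples n N - even_tuples n N. c m * ?t m) = c ?r"
    using sum.mono_neutral_right[of "tuples n N - even_tuples n N" "{?r}" "\<lambda>m. c m * ?t m"]
      finite_tuples zero r_mem by simp
  then show ?thesis
    using sum.subset_diff[OF sub finite_tuples, of "\<lambda>m. c m * ?t m"] by (simp add: add.commute)
qed

text \<open>The entries sum to \<open>N\<close>, so one denominator serves all tuples.\<close>

lemma bcoeff_prod_int: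
  assumes "m \<in> tuples n N"
  shows "\<exists>i. of_int (denom_bound N) * (\<Prod>i=1..n. bcoeff (m i)) = of_int i"
proof -
  obtain f where f: "\<And>k. of_int (denom_bound k) * bcoeff k = of_int (f k)"
    using bcoeff_int by metis
  have "(\<Prod>i=1..n. denom_bound (m i)) dvd denom_bound N"
    using prod_denom_bound_dvd[of "{1..n}" m] assms by (simp add: tuples_def)
  then obtain k where "denom_bound N = (\<Prod>i=1..n. denom_bound (m i)) * k"
    by (elim dvdE)
  then have "of_int (denom_bound N) * (\<Prod>i=1..n. bcoeff (m i)) = of_int k * (\<Prod>i=1..n. of_int (denom_bound (m i)) * bcoeff (m i))"
    by (simp add: prod.distrib)
  also have "\<dots> = of_int (k * (\<Prod>i=1..n. f (m i)))"
    by (simp add: f)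
  finally show ?thesis ..
qed

text \<open>Each factor is replaced modulo \<open>q\<close> by a series \<open>G i\<close> with
  explicit coefficients; \<open>k\<close> collects the error.\<close>

lemma inverse_quotient_product_nth:
  fixes r a b l :: "nat \<Rightarrow> nat"
  assumes r: "\<And>i. i \<in> {1..n} \<Longrightarrow> r i > 0"
    and a: "\<And>i. i \<in> {1..n} \<Longrightarrow> a i > 0"
    and ab: "\<And>i. i \<in> {1..n} \<Longrightarrow> a i * b i = 1 + l i * q"
  shows "\<exists>k. of_int (denom_bound N) * fps_nth (\<Prod>i=1..n. hpoly_half (r i)
          (eval_at (fps_exp 1) (inverse_quotient (a i) (b i)) * bgf) fps_X) N
    = (\<Prod>i=1..n. 2 * fact (r i - 1)) * (\<Sum>m\<in>tuples n N. of_int (denom_bound N) * (\<Prod>i=1..n. bcoeff (m i))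
        * of_int (\<Prod>i=1..n. binomial_int (int (m i) - 1) (r i - 1) * (int (b i) ^ r i * int (a i) ^ m i)))
      + of_int (int q * k)"
proof -
  define F where "F i = hpoly_half (r i)
      (eval_at (fps_exp 1) (inverse_quotient (a i) (b i)) * bgf) fps_X" for i
  define G where "G i = of_nat (b i) ^ r i * (hpoly_half (r i) bgf fps_X oo (fps_const (of_nat (a i)) * fps_X))"
    for i
  have F: "int_fps 1 (F i)" if "i \<in> {1..n}" for i
    unfolding F_def by (intro int_fps_hpoly_half inverse_quotient_series(1)[OF a ab] that int_fps_X)
  have FG: "int_fps (int q) (F i - G i)" if "i \<in> {1..n}" for i
    unfolding F_def G_def by (intro hpoly_half_inverse_quotient[OF a r ab] that)
  \<comment> \<open>Integrality of \<open>G i\<close> is inherited from \<open>F i\<close> through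
    the congruence.\<close>
  have "int_fps 1 (G i)" if "i \<in> {1..n}" for i
    using int_fps_diff[OF F[OF that] int_fps_weaken[OF FG[OF that]]] by simp
  then have "int_fps (int q) ((\<Prod>i=1..n. F i) - (\<Prod>i=1..n. G i))"
    using F FG by (intro int_fps_prod_diff) auto
  then obtain k where "of_int (denom_bound N) * fps_nth ((\<Prod>i=1..n. F i) - (\<Prod>i=1..n. G i)) N = of_int (int q * k)"
    by (rule int_fpsD)
  then have k: "of_int (denom_bound N) * fps_nth (\<Prod>i=1..n. F i) N
      = of_int (denom_bound N) * fps_nth (\<Prod>i=1..n. G i) N + of_int (int q * k)"
    by (simp add: right_diff_distrib)
  have G: "fps_nth (G i) m = (2 * fact (r i - 1)) * (bcoeff m
      * of_int (binomial_int (int m - 1) (r i - 1) * (int (b i) ^ r i * int (a i) ^ m)))"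
    if "i \<in> {1..n}" for i m
  proof -
    have "(of_nat (b i) ^ r i :: real fps) = fps_const (real (b i) ^ r i)"
      by (simp add: fps_const_power flip: fps_of_nat)
    then have "fps_nth (G i) m = real (b i) ^ r i * (real (a i) ^ m * fps_nth (hpoly_half (r i) bgf fps_X) m)"
      unfolding G_def by simp
    then show ?thesis
      unfolding hpoly_half_bgf[OF r[OF that]] by (simp add: of_int_binomial_int mult_ac)
  qed
  have "fps_nth (\<Prod>i=1..n. G i) N = (\<Sum>m\<in>tuples n N. (\<Prod>i=1..n. 2 * fact (r i - 1))
      * ((\<Prod>i=1..n. bcoeff (m i))
      * of_int (\<Prod>i=1..n. binomial_int (int (m i) - 1) (r i - 1) * (int (b i) ^ r i * int (a i) ^ m i))))"
    unfolding fps_prod_nth_tuples of_int_prod prod.distrib[symmetric]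
    by (intro sum.cong prod.cong refl G)
  then have "of_int (denom_bound N) * fps_nth (\<Prod>i=1..n. G i) N
      = (\<Prod>i=1..n. 2 * fact (r i - 1)) * (\<Sum>m\<in>tuples n N. of_int (denom_bound N) * (\<Prod>i=1..n. bcoeff (m i))
        * of_int (\<Prod>i=1..n. binomial_int (int (m i) - 1) (r i - 1) * (int (b i) ^ r i * int (a i) ^ m i)))"
    by (simp only: sum_distrib_left mult_ac)
  then show ?thesis
    using k unfolding F_def by metis
qed

section \<open>Choice of the constant d and the final congruence\<close>

theorem theorem1p2:
  fixes n N :: nat
  assumes "n \<ge> 2" and "N \<ge> 1"
  shows "\<exists>d::nat. d > 0 \<and>
    (\<exists>c :: (nat \<Rightarrow> nat) \<Rightarrow> int.
      (\<forall>m \<in> even_tuples n N.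
         real_of_int (c m) = real d * (\<Prod>i=1..n. bernoulli_number (m i) / fact (m i))) \<and>
      (\<forall>(r :: nat \<Rightarrow> nat) (q :: int) (p :: nat \<Rightarrow> int).
         (\<forall>i\<in>{1..n}. r i > 0) \<longrightarrow> (\<Sum>i=1..n. r i) = N \<longrightarrow>
         q \<ge> 1 \<longrightarrow> (\<forall>i\<in>{1..n-1}. gcd (p i) q = 1) \<longrightarrow>
         (\<exists>S :: int.
            real_of_int S =
              real d * real_of_int q ^ (N - n + 1) / (\<Prod>i=1..n. fact (r i)) *
              dedekind_sum n r q p \<and>
            [S = (\<Sum>m \<in> even_tuples n N.
                    - c m * (\<Prod>i=1..n.
                      binomial_int (int (m i) - 1) (r i - 1) *
                      mod_power_int q ((p(n := -1)) i) (int (m i) - int (r i))))] (mod q))))"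
proof -
  obtain D :: nat where D: "D > 0"
    "\<And>q h. q > 0 \<Longrightarrow> \<exists>i. of_nat D * root_residue_sum q N h = of_int (int q * i)"
    using root_residue_sum_dvd[of N] by blast
  have "\<exists>e. \<forall>m\<in>tuples n N. of_int (denom_bound N) * (\<Prod>i=1..n. bcoeff (m i)) = of_int (e m)"
    by (intro bchoice ballI bcoeff_prod_int)
  then obtain e where
    e: "\<And>m. m \<in> tuples n N \<Longrightarrow> of_int (denom_bound N) * (\<Prod>i=1..n. bcoeff (m i)) = of_int (e m)"
    by blast
  define w where "w = nat (denom_bound N)"
  have w: "of_int (denom_bound N) = real w" "w > 0"
    using denom_bound_pos[of N] by (simp_all add: w_def)
  \<comment> \<open>A common multiple of the products of \<open>2 * fact (r i - 1)\<close>, so that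
    \<open>d\<close> does not depend on \<open>r\<close>. In \<open>d\<close>, \<open>D\<close>
    serves the root sums and \<open>w\<close> the Bernoulli products.\<close>
  define f :: nat where "f = (2 * fact N) ^ n"
  define d where "d = f * D * w"
  define c where "c m = int (f * D) * e m" for m
  have c: "of_int (c m) = real d * (\<Prod>i=1..n. bcoeff (m i))" if "m \<in> tuples n N" for m
    using e[OF that] w by (simp add: c_def d_def mult.assoc)
  show ?thesis
  proof (intro exI[of _ d] exI[of _ c] conjI ballI allI impI)
    show "d > 0"
      using D(1) w(2) by (simp add: d_def f_def)
  next
    fix m assume m: "m \<in> even_tuples n N"
    then have "m \<in> tuples n N"
      by (simp add: even_tuples_def tuples_def)
    moreover have "(\<Prod>i=1..n. bcoeff (m i)) = (\<Prod>i=1..n. bernoulli_number (m i) / fact (m i))"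
      using m by (intro prod.cong refl bcoeff_even) (simp add: even_tuples_def)
    ultimately show "real_of_int (c m) = real d * (\<Prod>i=1..n. bernoulli_number (m i) / fact (m i))"
      using c by simp
  next
    fix r :: "nat \<Rightarrow> nat" and q :: int and p :: "nat \<Rightarrow> int"
    assume r: "\<forall>i\<in>{1..n}. r i > 0" and rN: "(\<Sum>i=1..n. r i) = N" and q1: "q \<ge> 1"
      and gcd: "\<forall>i\<in>{1..n-1}. gcd (p i) q = 1"
    define Q where "Q = nat q"
    have Q: "q = int Q" "Q > 0"
      using q1 by (simp_all add: Q_def)
    let ?p = "p(n := - 1)"
    have "coprime (?p i) (int Q)" if "i \<in> {1..n}" for i
      using gcd that Q(1) by (cases "i = n") (auto simp: coprime_iff_gcd_eq_1)
    then have "\<forall>i. \<exists>a b l. i \<in> {1..n} \<longrightarrow> a > 0 \<and> a * b = 1 + l * Q \<and> [int a = ?p i] (mod int Q)"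
      using natural_representatives[OF Q(2)] by blast
    then obtain a b l where abl: "\<And>i. i \<in> {1..n} \<Longrightarrow> a i > 0"
        "\<And>i. i \<in> {1..n} \<Longrightarrow> a i * b i = 1 + l i * Q"
        "\<And>i. i \<in> {1..n} \<Longrightarrow> [int (a i) = ?p i] (mod int Q)"
      by metis
    define g where "g = (\<Prod>i=1..n. 2 * fact (r i - 1) :: nat)"
    have "r i \<le> N" if "i \<in> {1..n}" for i
      using member_le_sum[of i "{1..n}" r] that rN by simp
    then have "g dvd (\<Prod>i=1..n. 2 * fact N)"
      unfolding g_def by (intro prod_dvd_prod mult_dvd_mono dvd_refl fact_dvd) (simp add: le_diff_conv le_SucI)
    then obtain g' where g': "f = g * g'"
      by (auto simp: f_def elim: dvdE)
    define A where "A = real_of_int q ^ (N - n + 1) / (\<Prod>i=1..n. fact (r i)) * dedekind_sum n r q p"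
    define B where "B = fps_nth (\<Prod>i=1..n. hpoly_half (r i)
          (eval_at (fps_exp 1) (inverse_quotient (a i) (b i)) * bgf) fps_X) N"
    define P where "P m = (\<Prod>i=1..n. binomial_int (int (m i) - 1) (r i - 1) * (int (b i) ^ r i * int (a i) ^ m i))"
      for m
    define M where "M m = (\<Prod>i=1..n. binomial_int (int (m i) - 1) (r i - 1) *
                      mod_power_int q (?p i) (int (m i) - int (r i)))" for m
    let ?b = "\<lambda>m. \<Prod>i=1..n. bcoeff (m i)"
    have gc: "(\<Prod>i=1..n. 2 * fact (r i - 1)) = (of_nat g :: 'a::{comm_semiring_1,semiring_char_0})"
      by (simp add: g_def)
    obtain i1 where i1: "of_nat D * (of_nat g * of_real A - of_nat g * of_real (?b r) + of_real B)
        = (of_int (int Q * i1) :: complex)"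
    proof -
      let ?R = "root_residue_sum Q N
        (\<Prod>i=1..n. hpoly_half (r i) (inverse_quotient (a i) (b i)) [:- 1, 1:])"
      have "of_real A = (\<Sum>j<Q. \<Prod>i=1..n. bernoulli_hat Q (r i) (int j * ?p i))"
        using dedekind_sum_fourier[of n Q r p] assms(1) Q r rN by (simp add: A_def)
      then have "of_nat g * of_real A = of_nat g * of_real (?b r) + ?R - of_real B"
        using sum_prod_bernoulli_hat[of Q n r N a b l ?p] abl Q r rN
        unfolding gc B_def by simp
      then have "of_nat g * of_real A - of_nat g * of_real (?b r) + of_real B = ?R"
        by (simp del: of_real_prod)
      then show ?thesis
        using D(2)[OF Q(2)] that by metis
    qed
    \<comment> \<open>All quantities are real, so the identity found over the complex numbers
      descends to the reals.\<close>
    have "complex_of_real (real D * (real g * A - real g * ?b r + B)) = of_real (of_int (int Q * i1))"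
      using i1 by simp
    then have i1: "real D * (real g * A - real g * ?b r + B) = of_int (int Q * i1)"
      unfolding of_real_eq_iff .
    obtain i2 where i2: "real w * B = real g * (\<Sum>m\<in>tuples n N. real w * ?b m * of_int (P m)) + of_int (int Q * i2)"
      using inverse_quotient_product_nth[of n r a b l Q N] abl r unfolding gc B_def P_def w by auto
    have r_mem: "restrict r {1..n} \<in> tuples n N"
      using rN by (simp add: tuples_def)
    define S where "S = q * (int (g' * w) * i1 - int (g' * D) * i2) + c (restrict r {1..n})
        - (\<Sum>m\<in>tuples n N. c m * P m)"
    \<comment> \<open>The first product is a multiple of \<open>q\<close> by \<open>i1\<close>, and
      the last one is expanded over tuples by \<open>i2\<close>; the identity itself rests on
      \<open>f = g * g'\<close>.\<close>
    have "real d * A = real (g' * w) * (real D * (real g * A - real g * ?b r + B))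
        + real d * ?b r - real (g' * D) * (real w * B)"
      by (simp add: d_def g' algebra_simps)
    also have "real (g' * D) * (real w * B)
        = (\<Sum>m\<in>tuples n N. real d * ?b m * of_int (P m)) + real (g' * D) * of_int (int Q * i2)"
      unfolding i2 by (simp add: d_def g' sum_distrib_left distrib_left mult_ac)
    also have "(\<Sum>m\<in>tuples n N. real d * ?b m * of_int (P m)) = (\<Sum>m\<in>tuples n N. of_int (c m * P m))"
      by (intro sum.cong refl) (simp add: c)
    also have "real d * ?b r = of_int (c (restrict r {1..n}))"
      unfolding c[OF r_mem] by simp
    finally have S: "real_of_int S = real d * A"
      unfolding i1 by (simp add: S_def Q(1) algebra_simps)
    have "[P m = M m] (mod q)" for m
      unfolding P_def M_def
    proof (intro cong_prod cong_mult cong_refl)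
      fix i assume i: "i \<in> {1..n}"
      have "[int (a i) * int (b i) = 1] (mod q)"
        unfolding of_nat_mult[symmetric] abl(2)[OF i] by (simp add: Q(1) cong_iff_dvd_diff)
      then show "[int (b i) ^ r i * int (a i) ^ m i = mod_power_int q (?p i) (int (m i) - int (r i))] (mod q)"
        using abl(3)[OF i] Q(1) by (intro mod_power_int_cong) auto
    qed
    then have "[(\<Sum>m\<in>tuples n N. c m * P m) = (\<Sum>m\<in>tuples n N. c m * M m)] (mod q)"
      by (intro cong_sum cong_mult cong_refl)
    moreover have "[q * (int (g' * w) * i1 - int (g' * D) * i2) = 0] (mod q)"
      by (simp add: cong_0_iff)
    ultimately have "[S = 0 + c (restrict r {1..n}) - (\<Sum>m\<in>tuples n N. c m * M m)] (mod q)"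
      unfolding S_def by (intro cong_add cong_diff cong_refl)
    \<comment> \<open>The extra summand from the tuple \<open>r\<close> cancels the contribution of
      the root 1 to \<open>S\<close>.\<close>
    moreover have "(\<Sum>m\<in>tuples n N. c m * M m)
        = (\<Sum>m\<in>even_tuples n N. c m * M m) + c (restrict r {1..n})"
      unfolding M_def
    proof (rule sum_tuples_split)
      fix m i assume m: "m \<in> tuples n N" and i: "i \<in> {1..n}" "odd (m i)"
      then have "?b m = 0"
        using bcoeff_odd[OF i(2)] by (intro prod_zero) blast+
      then have "real_of_int (c m) = 0"
        unfolding c[OF m] by (simp only: mult_zero_right)
      then show "c m = 0"
        by simp
    qed (use r rN in auto)
    ultimately have "[S = (\<Sum>m\<in>even_tuples n N. - c m * M m)] (mod q)"
      by (simp add: sum_negf)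
    with S show "\<exists>S :: int.
            real_of_int S =
              real d * real_of_int q ^ (N - n + 1) / (\<Prod>i=1..n. fact (r i)) *
              dedekind_sum n r q p \<and>
            [S = (\<Sum>m \<in> even_tuples n N.
                    - c m * (\<Prod>i=1..n.
                      binomial_int (int (m i) - 1) (r i - 1) *
                      mod_power_int q (?p i) (int (m i) - int (r i))))] (mod q)"
      unfolding A_def M_def by (intro exI[of _ S]) simp
  qed
qed

end
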